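(* Let $\lambda:[0,+\infty)\to[0,+\infty)$ be a strictly monotone increasing continuous function. Let $X$ be an essentially connected compact geodesic mm-space with a fully supported Borel probability measure $\mu_X$. Assume that $X$ satisfies $\mathrm{IC}(\nu)$ for a measure $\nu\in\mathcal V$ with compact support. Then $$\operatorname{diam}X\le\operatorname{diam}\operatorname{supp}\nu.$$ The equality holds if and only if $\mathrm{ObsVar}_\lambda(X)=\mathrm{Var}_\lambda(\nu)$. Consequently, in the equality case, $X$ is covered by minimal geodesics joining two fixed points $p$ and $q$ in $X$ with $d_X(p,q)=\operatorname{diam}X$, and $X$ is homeomorphic to a suspension provided $X$ is non-branching.
   Context: An mm-space is a complete separable metric space $(X,d_X)$ with a Borel probability measure $\mu_X$. It is geodesic if any two points are joined by a minimal geodesic (a curve whose length equals the distance of its endpoints). For a Borel set $A\subset X$, $\mu_X^+(A):=\limsup_{\varepsilon\to0+}\frac{\mu_X(U_\varepsilon(A))-\mu_X(A)}{\varepsilon}$, where $U_\varepsilon(A)$ is the open $\varepsilon$-neighborhood of $A$. $X$ is essentially connected if $\mu_X^+(A)>0$ for any closed set $A\subset X$ with $0<\mu_X(A)<1$. Let $\operatorname{Im}\mu_X$ be the set of values $\mu_X(A)$, $A\subset X$ Borel, and $I_X(v):=\inf\{\mu_X^+(A)\mid A\subset X\text{ Borel},\ \mu_X(A)=v\}$ for $v\in\operatorname{Im}\mu_X$. For a Borel probability measure $\nu$ on $\mathbb R$ with cumulative distribution function $V(t)=\nu((-\infty,t])$, $X$ satisfies $\mathrm{IC}(\nu)$ if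 $I_X\circ V\ge V'$ holds $\mathcal L^1$-a.e. on $V^{-1}(\operatorname{Im}\mu_X)$, where $\mathcal L^1$ is the Lebesgue measure on $\mathbb R$. $\mathcal V$ is the set of Borel probability measures on $\mathbb R$ absolutely continuous with respect to $\mathcal L^1$ and with connected support. $\mathrm{Var}_\lambda(\nu):=\int_{\mathbb R}\int_{\mathbb R}\lambda(|x-x'|)\,d\nu(x)d\nu(x')$. $\mathrm{ObsVar}_\lambda(X)$ is the supremum over all $1$-Lipschitz functions $f:X\to\mathbb R$ of $\mathrm{Var}_\lambda(f):=\int_X\int_X\lambda(|f(x)-f(x')|)\,d\mu_X(x)d\mu_X(x')$. $X$ is non-branching if one cannot have two different minimal geodesics, parametrized by arclength on the same interval, that agree on a nontrivial initial subinterval. A suspension is a space obtained from $Y\times[0,1]$, for some space $Y$, by collapsing $Y\times\{0\}$ to a point and $Y\times\{1\}$ to a point. *)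

theory Defs
  imports "HOL-Probability.Probability"
begin

section \<open>Curves, geodesics and branching\<close>

text \<open>The length of a curve \<open>\<gamma>\<close> on \<open>[a, b]\<close>, \<open>a \<le> b\<close>, is the supremum over all
  partitions \<open>a = t 0 \<le> \<dots> \<le> t n = b\<close>; it may be infinite.\<close>

definition curve_length :: "(real \<Rightarrow> 'a::metric_space) \<Rightarrow> real \<Rightarrow> real \<Rightarrow> ennreal" where
  "curve_length \<gamma> a b =
     (SUP (n, t) \<in> {(n :: nat, t :: nat \<Rightarrow> real).
                      t 0 = a \<and> t n = b \<and> (\<forall>i<n. t i \<le> t (Suc i))}.
        \<Sum>i<n. ennreal (dist (\<gamma> (t i)) (\<gamma> (t (Suc i)))))"

definition minimal_geodesic :: "(real \<Rightarrow> 'a::metric_space) \<Rightarrow> real \<Rightarrow> real \<Rightarrow> bool" where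
  "minimal_geodesic \<gamma> a b \<longleftrightarrow>
     a \<le> b \<and> continuous_on {a..b} \<gamma> \<and> curve_length \<gamma> a b = ennreal (dist (\<gamma> a) (\<gamma> b))"

definition minimal_geodesic_joining ::
    "(real \<Rightarrow> 'a::metric_space) \<Rightarrow> real \<Rightarrow> real \<Rightarrow> 'a \<Rightarrow> 'a \<Rightarrow> bool" where
  "minimal_geodesic_joining \<gamma> a b p q \<longleftrightarrow> minimal_geodesic \<gamma> a b \<and> \<gamma> a = p \<and> \<gamma> b = q"

definition geodesic_space :: "'a::metric_space itself \<Rightarrow> bool" where
  "geodesic_space _ \<longleftrightarrow> (\<forall>p q :: 'a. \<exists>\<gamma> a b. minimal_geodesic_joining \<gamma> a b p q)"

definition arclength_parametrized ::
    "(real \<Rightarrow> 'a::metric_space) \<Rightarrow> real \<Rightarrow> real \<Rightarrow> bool" where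
  "arclength_parametrized \<gamma> a b \<longleftrightarrow>
     (\<forall>s t. a \<le> s \<longrightarrow> s \<le> t \<longrightarrow> t \<le> b \<longrightarrow> curve_length \<gamma> s t = ennreal (t - s))"

definition non_branching :: "'a::metric_space itself \<Rightarrow> bool" where
  "non_branching _ \<longleftrightarrow>
     (\<nexists>(\<gamma> :: real \<Rightarrow> 'a) \<sigma> a b c.
        minimal_geodesic \<gamma> a b \<and> arclength_parametrized \<gamma> a b \<and>
        minimal_geodesic \<sigma> a b \<and> arclength_parametrized \<sigma> a b \<and>
        a < c \<and> c \<le> b \<and> (\<forall>t\<in>{a..c}. \<gamma> t = \<sigma> t) \<and> (\<exists>t\<in>{a..b}. \<gamma> t \<noteq> \<sigma> t))"

section \<open>Suspensions\<close>

definition suspension_rel :: "'a topology \<Rightarrow> (('a \<times> real) \<times> ('a \<times> real)) set" where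
  "suspension_rel Y =
     {((y, s), (y', s')). y \<in> topspace Y \<and> y' \<in> topspace Y \<and> s \<in> {0..1} \<and> s' \<in> {0..1} \<and>
        (y = y' \<and> s = s' \<or> s = 0 \<and> s' = 0 \<or> s = 1 \<and> s' = 1)}"

text \<open>The points of the suspension are the equivalence classes in \<open>Y \<times> [0, 1]\<close>; it carries the
  quotient topology.\<close>

definition suspension :: "'a topology \<Rightarrow> ('a \<times> real) set topology" where
  "suspension Y = topology (\<lambda>U. U \<subseteq> (topspace Y \<times> {0..1}) // suspension_rel Y \<and>
     openin (prod_topology Y (top_of_set {0..1})) (\<Union>U))"

lemma equiv_suspension_rel: "equiv (topspace Y \<times> {0..1}) (suspension_rel Y)"
  unfolding suspension_rel_def by (auto intro!: equivI refl_onI symI transI)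

lemma openin_suspension:
  "openin (suspension Y) U \<longleftrightarrow> U \<subseteq> (topspace Y \<times> {0..1}) // suspension_rel Y \<and>
     openin (prod_topology Y (top_of_set {0..1})) (\<Union>U)"
proof -
  let ?Q = "(topspace Y \<times> {0..1::real}) // suspension_rel Y"
  have inter: "\<Union>(S \<inter> T) = \<Union>S \<inter> \<Union>T" if "S \<subseteq> ?Q" "T \<subseteq> ?Q" for S T
  proof
    show "\<Union>S \<inter> \<Union>T \<subseteq> \<Union>(S \<inter> T)"
    proof
      fix z assume "z \<in> \<Union>S \<inter> \<Union>T"
      then obtain A B where "A \<in> S" "B \<in> T" "z \<in> A" "z \<in> B" by blast
      moreover from this have "A = B"
        using quotient_disj[OF equiv_suspension_rel[of Y]] that by blast
      ultimately show "z \<in> \<Union>(S \<inter> T)" by blast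
    qed
  qed blast
  have "istopology (\<lambda>U. U \<subseteq> ?Q \<and> openin (prod_topology Y (top_of_set {0..1})) (\<Union>U))"
    unfolding istopology_def
  proof (intro conjI allI impI)
    fix \<K> :: "('a \<times> real) set set set"
    assume K: "\<forall>K\<in>\<K>. K \<subseteq> ?Q \<and> openin (prod_topology Y (top_of_set {0..1})) (\<Union>K)"
    then show "\<Union>\<K> \<subseteq> ?Q" by blast
    have "\<Union>(\<Union>\<K>) = \<Union>(Union ` \<K>)" by blast
    moreover have "openin (prod_topology Y (top_of_set {0..1})) (\<Union>(Union ` \<K>))"
      by (rule openin_Union) (use K in blast)
    ultimately show "openin (prod_topology Y (top_of_set {0..1})) (\<Union>(\<Union>\<K>))"
      by (simp only:)
  next
    fix S T :: "('a \<times> real) set set"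
    assume S: "S \<subseteq> ?Q \<and> openin (prod_topology Y (top_of_set {0..1})) (\<Union>S)"
      and T: "T \<subseteq> ?Q \<and> openin (prod_topology Y (top_of_set {0..1})) (\<Union>T)"
    from S show "S \<inter> T \<subseteq> ?Q" by blast
    have "\<Union>(S \<inter> T) = \<Union>S \<inter> \<Union>T" using S T by (intro inter) blast+
    moreover have "openin (prod_topology Y (top_of_set {0..1})) (\<Union>S \<inter> \<Union>T)"
      using S T by (intro openin_Int) blast+
    ultimately show "openin (prod_topology Y (top_of_set {0..1})) (\<Union>(S \<inter> T))"
      by (simp only:)
  qed
  then show ?thesis
    unfolding suspension_def by (subst topology_inverse') (assumption, rule refl)
qed

lemma topspace_suspension: "topspace (suspension Y) = (topspace Y \<times> {0..1}) // suspension_rel Y"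
proof -
  have "\<Union>((topspace Y \<times> {0..1::real}) // suspension_rel Y) = topspace Y \<times> {0..1}"
    by (rule Union_quotient[OF equiv_suspension_rel])
  then have "openin (suspension Y) ((topspace Y \<times> {0..1}) // suspension_rel Y)"
    unfolding openin_suspension by (simp add: openin_prod_Times_iff)
  then have "(topspace Y \<times> {0..1}) // suspension_rel Y \<subseteq> topspace (suspension Y)"
    by (rule openin_subset)
  moreover have "topspace (suspension Y) \<subseteq> (topspace Y \<times> {0..1}) // suspension_rel Y"
    using openin_topspace[of "suspension Y"] unfolding openin_suspension by (rule conjunct1)
  ultimately show ?thesis by (rule subset_antisym[rotated])
qed

section \<open>Measures\<close>

text \<open>The metric structure of an mm-space is the one of its type; class \<open>polish_space\<close> provides
  completeness and separability.\<close>

definition mm_space :: "'a::polish_space measure \<Rightarrow> bool" where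
  "mm_space M \<longleftrightarrow> prob_space M \<and> sets M = sets borel"

definition measure_support :: "'a::topological_space measure \<Rightarrow> 'a set" where
  "measure_support M = {x. \<forall>U. open U \<longrightarrow> x \<in> U \<longrightarrow> emeasure M U > 0}"

definition open_nbhd :: "real \<Rightarrow> 'a::metric_space set \<Rightarrow> 'a set" where
  "open_nbhd \<epsilon> A = {x. \<exists>a\<in>A. dist x a < \<epsilon>}"

definition boundary_measure :: "'a::metric_space measure \<Rightarrow> 'a set \<Rightarrow> ereal" where
  "boundary_measure M A =
     Limsup (at_right 0) (\<lambda>\<epsilon>. ereal ((measure M (open_nbhd \<epsilon> A) - measure M A) / \<epsilon>))"

definition essentially_connected :: "'a::metric_space measure \<Rightarrow> bool" where
  "essentially_connected M \<longleftrightarrow>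
     (\<forall>A. closed A \<longrightarrow> 0 < measure M A \<longrightarrow> measure M A < 1 \<longrightarrow> boundary_measure M A > 0)"

definition measure_values :: "'a measure \<Rightarrow> real set" where
  "measure_values M = measure M ` sets M"

definition isoperimetric_profile :: "'a::metric_space measure \<Rightarrow> real \<Rightarrow> ereal" where
  "isoperimetric_profile M v = (INF A \<in> {A \<in> sets M. measure M A = v}. boundary_measure M A)"

text \<open>The function \<open>cdf \<nu>\<close> is monotone, hence differentiable almost everywhere, so the
  arbitrary value of \<open>deriv\<close> at other points does not matter.\<close>

definition IC :: "'a::metric_space measure \<Rightarrow> real measure \<Rightarrow> bool" where
  "IC M \<nu> \<longleftrightarrow>
     (AE t in lborel. cdf \<nu> t \<in> measure_values M \<longrightarrow>
        isoperimetric_profile M (cdf \<nu> t) \<ge> ereal (deriv (cdf \<nu>) t))"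

definition class_V :: "real measure set" where
  "class_V = {\<nu>. real_distribution \<nu> \<and> absolutely_continuous lborel \<nu> \<and>
                 connected (measure_support \<nu>)}"

section \<open>Observable variance\<close>

definition Var_fun :: "(real \<Rightarrow> real) \<Rightarrow> 'a measure \<Rightarrow> ('a \<Rightarrow> real) \<Rightarrow> ennreal" where
  "Var_fun lam M f = (\<integral>\<^sup>+x. \<integral>\<^sup>+x'. ennreal (lam \<bar>f x - f x'\<bar>) \<partial>M \<partial>M)"

definition Var_measure :: "(real \<Rightarrow> real) \<Rightarrow> real measure \<Rightarrow> ennreal" where
  "Var_measure lam \<nu> = (\<integral>\<^sup>+x. \<integral>\<^sup>+x'. ennreal (lam \<bar>x - x'\<bar>) \<partial>\<nu> \<partial>\<nu>)"

definition ObsVar :: "(real \<Rightarrow> real) \<Rightarrow> 'a::metric_space measure \<Rightarrow> ennreal" where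
  "ObsVar lam M = (SUP f \<in> {f. 1-lipschitz_on UNIV f}. Var_fun lam M f)"

end

theory Submission
  imports Defs
begin

text \<open>
  Let \<open>[c, d]\<close> be the support of \<open>\<nu>\<close>.  Everything rests on one fact: the law of any 1-Lipschitz
  function \<open>f\<close> on the space is the image of \<open>\<nu>\<close> under a monotone 1-Lipschitz map \<open>T\<close>
  (\<open>lipschitz_is_transported\<close>).  Indeed, if \<open>F\<close> is the distribution function of \<open>f\<close>, then the
  \<open>\<epsilon>\<close>-neighbourhood of \<open>{f \<le> t}\<close> lies in \<open>{f \<le> t + \<epsilon>}\<close>, so the upper right derivative of \<open>F\<close>
  at \<open>t\<close> is at least the isoperimetric profile at \<open>F t\<close>, and hence at least the derivative of
  \<open>cdf \<nu>\<close> at the point \<open>H t\<close> with \<open>cdf \<nu> (H t) = F t\<close>.  Thus \<open>H\<close> has derivative at least 1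
  wherever the comparison is available, and \<open>T\<close> is the inverse of \<open>H\<close>.  The points where it is not
  available form a \<open>\<nu>\<close>-null set of values of \<open>H\<close>.  There essential connectedness still gives \<open>F\<close>
  a positive upper derivative, and a monotone correction of arbitrarily small total variation that
  is infinitely steep relative to \<open>cdf \<nu>\<close> on that null set repairs the argument
  (\<open>steep_mono_on_null_set\<close>, \<open>quantile_expansion\<close>).

  For \<open>f = dist p\<close> with \<open>p\<close> an end of a diameter, the range of \<open>f\<close> is as long as the diameter but
  no longer than \<open>d - c\<close>, which is the inequality.  If the diameter \<open>R\<close> is smaller than \<open>d - c\<close>, then
  all variances \<open>Var_fun lam M f\<close> are bounded by the variance of \<open>\<nu>\<close> with distances capped at \<open>R\<close>,
  which is strictly smaller than that of \<open>\<nu>\<close> (\<open>capped_variance_less\<close>).  If it equals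
  \<open>d - c\<close>, then the rearrangement for \<open>dist p\<close> is a translation, so that the variance of \<open>\<nu>\<close> is
  attained (\<open>diameter_eq_iff_ObsVar_eq\<close>).

  In the equality case let \<open>p\<close> and \<open>q\<close> realize the diameter.  The functions \<open>dist p\<close> and
  \<open>dist p q - dist q\<close> have the same law, being extremal, and the first dominates the second; so they
  are equal, and every point lies on a minimal geodesic from \<open>p\<close> to \<open>q\<close>.  Without branching, this
  geodesic is unique for points other than \<open>p\<close> and \<open>q\<close>, and its midpoint and the height on it are
  suspension coordinates (\<open>homeomorphic_suspension_between_poles\<close>).
\<close>

section \<open>Growth of monotone functions and differentiability of distribution functions\<close>

text \<open>A pointwise lower bound on right increments integrates up with no exceptional set: the last point
up to which the claimed growth holds can be pushed further to the right.  Monotonicity replaces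
continuity here, since upward jumps only help.  Asking for the bound at every point, rather than
almost everywhere, is what makes a covering argument unnecessary; null sets are dealt with
beforehand by \<open>steep_mono_on_null_set\<close>.\<close>

lemma growth_of_mono_from_right_increments:
  fixes K :: "real \<Rightarrow> real"
  assumes le: "u \<le> v" and th: "\<theta> \<ge> 0"
    and mono: "\<And>x y. u \<le> x \<Longrightarrow> x \<le> y \<Longrightarrow> y \<le> v \<Longrightarrow> K x \<le> K y"
    and dini: "\<And>t. u \<le> t \<Longrightarrow> t < v \<Longrightarrow> \<exists>\<^sub>F \<epsilon> in at_right 0. K (t + \<epsilon>) - K t \<ge> \<theta> * \<epsilon>"
  shows "K v - K u \<ge> \<theta> * (v - u)"
proof -
  define S where "S = {t\<in>{u..v}. K t - K u \<ge> \<theta> * (t - u)}"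
  define z where "z = Sup S"
  have uS: "u \<in> S" using le by (simp add: S_def)
  have bdd: "bdd_above S" by (auto simp: S_def bdd_above_def)
  have z: "u \<le> z" "z \<le> v"
    unfolding z_def using cSup_upper[OF uS bdd] uS
    by (auto intro!: cSup_least simp: S_def)
  have zS: "z \<in> S"
  proof -
    have "\<theta> * (z - u) \<le> K z - K u"
    proof (rule field_le_epsilon)
      fix e :: real assume e: "e > 0"
      define e' where "e' = e / (\<theta> + 1)"
      have e': "e' > 0" "\<theta> * e' \<le> e" using e th by (auto simp: e'_def field_simps)
      obtain t where t: "t \<in> S" "z - e' < t"
        using less_cSupE[of "z - e'" S] uS e'(1) z_def
        by (metis diff_less_eq empty_iff less_add_same_cancel1)
      have tz: "t \<le> z" using t(1) bdd cSup_upper z_def by auto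
      have "K t \<le> K z" using mono t(1) tz z by (auto simp: S_def)
      moreover have "\<theta> * (z - u) \<le> \<theta> * (t - u) + \<theta> * e'"
        using t(2) th mult_left_mono[of "z - u" "t - u + e'" \<theta>] by (simp add: algebra_simps)
      ultimately show "\<theta> * (z - u) \<le> K z - K u + e"
        using t(1) e'(2) by (auto simp: S_def)
    qed
    then show ?thesis using z by (simp add: S_def)
  qed
  have "z = v"
  proof (rule ccontr)
    assume "z \<noteq> v"
    then have "z < v" using z by simp
    have "\<forall>\<^sub>F \<epsilon> in at_right (0::real). \<epsilon> \<in> {0<..<v - z}"
      by (rule eventually_at_right_real) (use \<open>z < v\<close> in simp)
    then obtain \<epsilon> where \<epsilon>: "K (z + \<epsilon>) - K z \<ge> \<theta> * \<epsilon>" "0 < \<epsilon>" "\<epsilon> < v - z"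
      using frequently_ex[OF frequently_eventually_conj[OF dini[OF z(1) \<open>z < v\<close>]]] by force
    then have "z + \<epsilon> \<in> S" using zS z by (auto simp: S_def algebra_simps)
    then have "z + \<epsilon> \<le> z" unfolding z_def by (rule cSup_upper[OF _ bdd])
    with \<epsilon> show False by simp
  qed
  with zS show ?thesis by (simp add: S_def)
qed

lemma indefinite_integral_has_right_derivative_AE:
  fixes g :: "real \<Rightarrow> real"
  assumes "\<And>a b. g integrable_on {a..b}"
  obtains N where "negligible N"
    "\<And>x. x \<notin> N \<Longrightarrow> ((\<lambda>h. integral {x..x+h} g / h) \<longlongrightarrow> g x) (at_right 0)"
proof -
  obtain N where N: "negligible N"
    "\<And>x e. \<lbrakk>x \<notin> N; 0 < e\<rbrakk> \<Longrightarrow> \<exists>d>0. \<forall>h. 0 < h \<and> h < d \<longrightarrow>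
        norm (integral (cbox x (x + h *\<^sub>R One)) g /\<^sub>R h ^ DIM(real) - g x) < e"
    using integrable_ccontinuous_explicit[of g] assms by (metis cbox_interval)
  show thesis
  proof (rule that[OF N(1)])
    fix x assume x: "x \<notin> N"
    show "((\<lambda>h. integral {x..x+h} g / h) \<longlongrightarrow> g x) (at_right 0)"
    proof (rule tendstoI)
      fix e :: real assume "e > 0"
      from N(2)[OF x this] obtain d where d: "d > 0" "\<And>h. 0 < h \<Longrightarrow> h < d \<Longrightarrow>
          norm (integral (cbox x (x + h *\<^sub>R One)) g /\<^sub>R h ^ DIM(real) - g x) < e" by blast
      show "\<forall>\<^sub>F h in at_right 0. dist (integral {x..x+h} g / h) (g x) < e"
        using eventually_at_right_real[OF d(1)]
        by eventually_elim (use d(2) in \<open>simp add: dist_real_def divide_inverse mult.commute\<close>)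
    qed
  qed
qed

text \<open>The averages of \<open>g\<close> over \<open>[x, x + h]\<close> only yield the right derivative of \<open>V\<close>; the left one comes
from the reflected integrand.\<close>

lemma indefinite_integral_differentiable_AE:
  fixes g V :: "real \<Rightarrow> real"
  assumes g: "\<And>a b. g integrable_on {a..b}"
    and V: "\<And>a b. a \<le> b \<Longrightarrow> V b - V a = integral {a..b} g"
  shows "\<exists>N. negligible N \<and> (\<forall>x. x \<notin> N \<longrightarrow> V field_differentiable at x)"
proof -
  obtain N1 where N1: "negligible N1"
    "\<And>x. x \<notin> N1 \<Longrightarrow> ((\<lambda>h. integral {x..x+h} g / h) \<longlongrightarrow> g x) (at_right 0)"
    using indefinite_integral_has_right_derivative_AE[OF g] by blast
  have "(\<lambda>x. g (- x)) integrable_on {a..b}" for a b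
    using g[of "-b" "-a"] Henstock_Kurzweil_Integration.integrable_reflect_real[where f=g and a="-b" and b="-a"] by simp
  then obtain N2 where N2: "negligible N2"
    "\<And>x. x \<notin> N2 \<Longrightarrow> ((\<lambda>h. integral {x..x+h} (\<lambda>x. g (-x)) / h) \<longlongrightarrow> g (-x)) (at_right 0)"
    using indefinite_integral_has_right_derivative_AE[of "\<lambda>x. g (- x)"] by blast
  have "negligible (uminus ` N2)"
    using N2(1) by (intro negligible_differentiable_image_negligible) (auto simp: differentiable_on_def)
  moreover have "V field_differentiable at x" if x: "x \<notin> N1 \<union> uminus ` N2" for x
  proof -
    have 1: "((\<lambda>h. (V (x + h) - V x) / h) \<longlongrightarrow> g x) (at_right 0)"
    proof (rule Lim_transform_eventually[OF N1(2)])
      show "x \<notin> N1" using x by simp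
      show "\<forall>\<^sub>F h in at_right 0. integral {x..x+h} g / h = (V (x + h) - V x) / h"
        using eventually_at_right_less[of "0::real"]
        by eventually_elim (use V[of x] in auto)
    qed
    have 2: "((\<lambda>h. (V (x - h) - V x) / (- h)) \<longlongrightarrow> g x) (at_right 0)"
    proof (rule Lim_transform_eventually)
      have "- x \<notin> N2" using x by force
      from N2(2)[OF this]
      show "((\<lambda>h. integral {-x..-x+h} (\<lambda>x. g (-x)) / h) \<longlongrightarrow> g x) (at_right 0)" by simp
      show "\<forall>\<^sub>F h in at_right 0. integral {-x..-x+h} (\<lambda>x. g (-x)) / h = (V (x - h) - V x) / (- h)"
        using eventually_at_right_less[of "0::real"]
      proof eventually_elim
        case (elim h)
        have "integral {-x..-x+h} (\<lambda>x. g (-x)) = integral {x - h..x} g"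
          using Henstock_Kurzweil_Integration.integral_reflect_real[where f=g and a="x-h" and b=x] by simp
        also have "\<dots> = V x - V (x - h)" using V[of "x-h" x] elim by simp
        finally show ?case by (simp add: minus_divide_left)
      qed
    qed
    have "((\<lambda>h. (V (x + h) - V x) / h) \<longlongrightarrow> g x) (at_left 0)"
      using 2 filterlim_at_left_to_right[of "(\<lambda>h. (V (x + h) - V x) / h)" "nhds (g x)" 0]
      by simp
    with 1 have "((\<lambda>h. (V (x + h) - V x) / h) \<longlongrightarrow> g x) (at 0)"
      by (simp add: filterlim_at_split)
    then have "DERIV V x :> g x" by (simp add: DERIV_def)
    then show ?thesis by (auto simp: field_differentiable_def)
  qed
  ultimately show ?thesis using N1(1) by (intro exI[of _ "N1 \<union> uminus ` N2"]) auto
qed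

text \<open>The hypothesis \<open>IC\<close> mentions \<open>deriv (cdf \<nu>)\<close>, which carries information only where the
derivative exists; for absolutely continuous \<open>\<nu>\<close> this is almost everywhere, by Lebesgue's
differentiation theorem for the density.\<close>

lemma cdf_differentiable_AE:
  assumes "real_distribution \<nu>" and ac: "absolutely_continuous lborel \<nu>"
  shows "AE x in lborel. cdf \<nu> field_differentiable at x"
proof -
  interpret real_distribution \<nu> by fact
  have sets: "sets \<nu> = sets lborel" by simp
  obtain g0 where g0: "g0 \<in> borel_measurable lborel" "density lborel g0 = \<nu>"
    using sigma_finite_measure.Radon_Nikodym[OF sigma_finite_lborel ac] sets by auto
  define g where "g = (\<lambda>x. enn2real (g0 x))"
  have "(\<integral>\<^sup>+x. g0 x \<partial>lborel) = emeasure \<nu> UNIV"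
    using g0(1) by (subst g0(2)[symmetric]) (simp add: emeasure_density)
  also have "\<dots> = 1" using emeasure_space_1 by simp
  finally have int1: "(\<integral>\<^sup>+x. g0 x \<partial>lborel) = 1" .
  have fin: "AE x in lborel. g0 x \<noteq> \<infinity>"
    using g0(1) int1 by (intro nn_integral_PInf_AE) auto
  have [measurable]: "g \<in> borel_measurable borel" using g0(1) unfolding g_def by measurable
  have ae: "AE x in lborel. g0 x = ennreal (g x)"
    using fin by eventually_elim (auto simp: g_def top.not_eq_extremum)
  have meas: "emeasure \<nu> A = (\<integral>\<^sup>+x\<in>A. ennreal (g x) \<partial>lborel)" if "A \<in> sets borel" for A
  proof -
    have "emeasure \<nu> A = (\<integral>\<^sup>+x\<in>A. g0 x \<partial>lborel)"
      using that g0(1) by (subst g0(2)[symmetric]) (simp add: emeasure_density)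
    also have "\<dots> = (\<integral>\<^sup>+x\<in>A. ennreal (g x) \<partial>lborel)"
      using ae by (intro nn_integral_cong_AE) auto
    finally show ?thesis .
  qed
  have gnn: "g x \<ge> 0" for x by (simp add: g_def)
  have HI: "(g has_integral measure \<nu> A) A" if A: "A \<in> sets borel" for A
  proof -
    have "((\<lambda>x. indicator A x * g x) has_integral measure \<nu> A) UNIV"
    proof (rule nn_integral_has_integral)
      have "(\<integral>\<^sup>+x. ennreal (indicator A x * g x) \<partial>lborel) = emeasure \<nu> A"
        unfolding meas[OF A] by (intro nn_integral_cong) (auto simp: indicator_def)
      then show "(\<integral>\<^sup>+x. ennreal (indicator A x * g x) \<partial>lborel) = ennreal (measure \<nu> A)"
        by (simp add: emeasure_eq_measure)
    qed (use A gnn in auto)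
    moreover have "(\<lambda>x. indicator A x * g x) = (\<lambda>x. if x \<in> A then g x else 0)"
      by (auto simp: indicator_def)
    ultimately show ?thesis by (simp add: has_integral_restrict_UNIV)
  qed
  have "\<exists>N. negligible N \<and> (\<forall>x. x \<notin> N \<longrightarrow> cdf \<nu> field_differentiable at x)"
  proof (rule indefinite_integral_differentiable_AE)
    show "g integrable_on {a..b}" for a b
      using HI[of "{a..b}"] by auto
    show "cdf \<nu> b - cdf \<nu> a = integral {a..b} g" if "a \<le> b" for a b
    proof -
      have "(g has_integral measure \<nu> {a<..b}) {a<..b}" by (rule HI) auto
      then have "(g has_integral measure \<nu> {a<..b}) {a..b}"
        by (subst has_integral_spike_set_eq[where T = "{a<..b}"])
          (auto intro: negligible_subset[of "{a}"])
      then have "integral {a..b} g = measure \<nu> {a<..b}" by (rule integral_unique)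
      then show ?thesis
        using cdf_diff_eq[of a b] that by (cases "a = b") auto
    qed
  qed
  then obtain N where "negligible N" "\<And>x. x \<notin> N \<Longrightarrow> cdf \<nu> field_differentiable at x" by blast
  then have "AE x in lebesgue. cdf \<nu> field_differentiable at x"
    by (intro AE_I'[of N]) (auto simp: negligible_iff_null_sets)
  then show ?thesis by (simp add: AE_completion_iff)
qed

section \<open>Laws supported on an interval\<close>

text \<open>A null set is covered by open sets \<open>U j\<close> of measure below \<open>e / 2 ^ (j + 1)\<close>, and \<open>\<Phi>\<close> is the
sum of the distribution functions of \<open>M\<close> restricted to the \<open>U j\<close>.  Near a point of the null set the
first \<open>m\<close> of these restrictions grow exactly like \<open>cdf M\<close>, so \<open>\<Phi>\<close> is infinitely steep there
relative to \<open>cdf M\<close>, although its total variation is at most \<open>e\<close>.  So along any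
parametrization for which \<open>cdf M\<close> grows at a positive rate, adding \<open>\<Phi>\<close> enforces any prescribed
growth at points of the null set, at negligible cost.\<close>

lemma (in finite_borel_measure) steep_mono_on_null_set:
  assumes N: "N \<in> null_sets M" and e: "e > 0"
  obtains \<Phi> where "mono \<Phi>" "\<And>s. 0 \<le> \<Phi> s" "\<And>s. \<Phi> s \<le> e"
    "\<And>s m::nat. s \<in> N \<Longrightarrow> \<exists>\<delta>>0. \<forall>h. 0 \<le> h \<longrightarrow> h < \<delta> \<longrightarrow>
        \<Phi> (s + h) - \<Phi> s \<ge> real m * (cdf M (s + h) - cdf M s)"
proof -
  have "\<exists>U. open U \<and> N \<subseteq> U \<and> measure M U < e * (1/2) ^ Suc j" for j
  proof -
    have "(INF U\<in>{U. N \<subseteq> U \<and> open U}. emeasure M U) = 0"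
      using outer_regular[of M N] N finite_emeasure_space M_is_borel by (auto simp: null_sets_def)
    also have "\<dots> < ennreal (e * (1/2) ^ Suc j)" using e by simp
    finally obtain U where "N \<subseteq> U" "open U" "emeasure M U < ennreal (e * (1/2) ^ Suc j)"
      by (auto simp: INF_less_iff)
    then show ?thesis using e by (intro exI[of _ U]) (auto simp: emeasure_eq_measure ennreal_less_iff)
  qed
  then obtain U where U: "\<And>j. open (U j)" "\<And>j. N \<subseteq> U j" "\<And>j. measure M (U j) < e * (1/2) ^ Suc j"
    by metis
  define \<phi> where "\<phi> = (\<lambda>j s. measure M (U j \<inter> {..s}))"
  have geo: "(\<lambda>j. e * (1/2) ^ Suc j) sums e"
    using sums_mult[OF power_half_series, of e] by simp
  have Um: "U j \<in> sets M" for j using U(1) by auto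
  have le: "\<phi> j s \<le> e * (1/2) ^ Suc j" for j s
    using finite_measure_mono[of "U j \<inter> {..s}" "U j"] U(3)[of j] Um[of j] by (simp add: \<phi>_def)
  have nn: "0 \<le> \<phi> j s" for j s by (simp add: \<phi>_def)
  have summ: "summable (\<lambda>j. \<phi> j s)" for s
    by (rule summable_comparison_test[OF _ sums_summable[OF geo]]) (use le nn in auto)
  have mono\<phi>: "\<phi> j s \<le> \<phi> j s'" if "s \<le> s'" for j s s'
    unfolding \<phi>_def using that Um[of j] M_is_borel by (intro finite_measure_mono) auto
  show thesis
  proof (rule that[of "\<lambda>s. \<Sum>j. \<phi> j s"])
    show "mono (\<lambda>s. \<Sum>j. \<phi> j s)"
      by (intro monoI suminf_le mono\<phi> summ)
    show "0 \<le> (\<Sum>j. \<phi> j s)" for s by (intro suminf_nonneg nn summ)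
    show "(\<Sum>j. \<phi> j s) \<le> e" for s
      using suminf_le[OF le summ sums_summable[OF geo]] sums_unique[OF geo] by simp
  next
    fix s and m :: nat assume s: "s \<in> N"
    have "open (\<Inter>j<m. U j)" using U(1) by auto
    moreover have "s \<in> (\<Inter>j<m. U j)" using U(2) s by auto
    ultimately obtain \<delta> where \<delta>: "\<delta> > 0" "ball s \<delta> \<subseteq> (\<Inter>j<m. U j)"
      by (meson open_contains_ball)
    have "real m * (cdf M (s + h) - cdf M s) \<le> (\<Sum>j. \<phi> j (s + h)) - (\<Sum>j. \<phi> j s)"
      if h: "0 \<le> h" "h < \<delta>" for h
    proof -
      have step: "\<phi> j (s + h) - \<phi> j s = cdf M (s + h) - cdf M s" if j: "j < m" for j
      proof (cases "h = 0")
        case False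
        then have "s < s + h" using h by simp
        have "{s<..s+h} \<subseteq> U j"
        proof
          fix x assume "x \<in> {s<..s+h}"
          then have "x \<in> ball s \<delta>" using h by (auto simp: dist_real_def)
          then show "x \<in> U j" using \<delta>(2) j by auto
        qed
        then have "U j \<inter> {..s+h} = (U j \<inter> {..s}) \<union> {s<..s+h}" using h by auto
        then have "\<phi> j (s + h) = measure M ((U j \<inter> {..s}) \<union> {s<..s+h})" by (simp add: \<phi>_def)
        also have "\<dots> = \<phi> j s + measure M {s<..s+h}"
          unfolding \<phi>_def using Um[of j] M_is_borel by (intro finite_measure_Union) auto
        finally show ?thesis using cdf_diff_eq[OF \<open>s < s + h\<close>] by simp
      qed simp
      have "real m * (cdf M (s + h) - cdf M s) = (\<Sum>j<m. \<phi> j (s + h) - \<phi> j s)"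
        by (simp add: step)
      also have "\<dots> \<le> (\<Sum>j. \<phi> j (s + h) - \<phi> j s)"
        using mono\<phi>[of s "s + h"] h by (intro sum_le_suminf summable_diff summ) auto
      also have "\<dots> = (\<Sum>j. \<phi> j (s + h)) - (\<Sum>j. \<phi> j s)" by (intro suminf_diff[symmetric] summ)
      finally show ?thesis .
    qed
    then show "\<exists>\<delta>>0. \<forall>h. 0 \<le> h \<longrightarrow> h < \<delta> \<longrightarrow>
        (\<Sum>j. \<phi> j (s + h)) - (\<Sum>j. \<phi> j s) \<ge> real m * (cdf M (s + h) - cdf M s)"
      using \<delta>(1) by blast
  qed
qed

text \<open>The laws in \<open>class_V\<close> with compact support, reduced to what the comparison of distribution
functions needs.\<close>

locale interval_law = real_distribution \<nu> for \<nu> +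
  fixes c d :: real
  assumes cd: "c < d"
    and cdf_c: "cdf \<nu> c = 0" and cdf_d: "cdf \<nu> d = 1"
    and isCont_V: "\<And>s. isCont (cdf \<nu>) s"
    and cdf_strict: "\<And>s s'. c \<le> s \<Longrightarrow> s < s' \<Longrightarrow> s' \<le> d \<Longrightarrow> cdf \<nu> s < cdf \<nu> s'"
begin

lemma cdf_le_iff:
  assumes "c \<le> s" "s < d"
  shows "cdf \<nu> x \<le> cdf \<nu> s \<longleftrightarrow> x \<le> s"
proof
  assume le: "cdf \<nu> x \<le> cdf \<nu> s"
  show "x \<le> s"
  proof (rule ccontr)
    assume "\<not> x \<le> s"
    then have "cdf \<nu> s < cdf \<nu> (min x d)" using assms by (intro cdf_strict) auto
    also have "\<dots> \<le> cdf \<nu> x" by (intro cdf_nondecreasing) auto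
    finally show False using le by simp
  qed
qed (rule cdf_nondecreasing)

lemma cdf_eq_0: "s \<le> c \<Longrightarrow> cdf \<nu> s = 0"
  using cdf_nondecreasing[of s c] cdf_c cdf_nonneg[of s] by simp

lemma cdf_eq_1: "d \<le> s \<Longrightarrow> cdf \<nu> s = 1"
  using cdf_nondecreasing[of d s] cdf_d cdf_bounded_prob[of s] by simp

lemma cdf_in_open_interval:
  assumes "0 < cdf \<nu> s" "cdf \<nu> s < 1" shows "c < s" "s < d"
  using assms cdf_eq_0[of s] cdf_eq_1[of s] by force+

lemma cdf_attains:
  assumes "0 \<le> v" "v \<le> 1" obtains s where "c \<le> s" "s \<le> d" "cdf \<nu> s = v"
  using IVT[of "cdf \<nu>" c v d] assms cd cdf_c cdf_d isCont_V by auto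

end

lemma null_complement_of_measure_support:
  fixes M :: "'a::second_countable_topology measure"
  assumes "sets M = sets borel"
  shows "UNIV - measure_support M \<in> null_sets M"
proof -
  obtain B :: "'a set set" where B: "countable B" "topological_basis B"
    using ex_countable_basis by blast
  define C where "C = {U\<in>B. emeasure M U = 0}"
  have "UNIV - measure_support M = \<Union>C"
  proof (intro equalityI subsetI)
    fix x assume "x \<in> UNIV - measure_support M"
    then obtain U where U: "open U" "x \<in> U" "emeasure M U = 0"
      by (auto simp: measure_support_def zero_less_iff_neq_zero)
    obtain W where W: "W \<in> B" "x \<in> W" "W \<subseteq> U"
      using topological_basisE[OF B(2) U(1,2)] by blast
    have "emeasure M W \<le> emeasure M U" using W U assms by (intro emeasure_mono) auto
    then show "x \<in> \<Union>C" using U(3) W by (auto simp: C_def)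
  next
    fix x assume "x \<in> \<Union>C"
    then show "x \<in> UNIV - measure_support M"
      using topological_basis_open[OF B(2)] by (auto simp: C_def measure_support_def)
  qed
  moreover have "(\<Union>U\<in>C. U) \<in> null_sets M"
  proof (rule null_sets_UN')
    show "countable C" using B(1) by (auto simp: C_def)
  next
    fix U assume "U \<in> C"
    then show "U \<in> null_sets M"
      using topological_basis_open[OF B(2)] assms by (auto simp: C_def null_sets_def)
  qed
  ultimately show ?thesis by (simp add: C_def)
qed

text \<open>The support is an interval by connectedness, and it is not a single point because an absolutely
continuous law has no atoms.\<close>

lemma interval_law_of_class_V:
  assumes nu: "\<nu> \<in> class_V" and cpt: "compact (measure_support \<nu>)"
  obtains c d where "measure_support \<nu> = {c..d}" "interval_law \<nu> c d"
proof -
  have rd: "real_distribution \<nu>" and ac: "absolutely_continuous lborel \<nu>"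
    and con: "connected (measure_support \<nu>)" using nu by (auto simp: class_V_def)
  interpret real_distribution \<nu> by fact
  have null: "A \<in> null_sets lborel \<Longrightarrow> A \<in> null_sets \<nu>" for A
    using ac by (auto simp: absolutely_continuous_def)
  obtain c d where cd: "measure_support \<nu> = {c..d}"
    using connected_compact_interval_1[of "measure_support \<nu>"] con cpt by metis
  have compl: "UNIV - {c..d} \<in> null_sets \<nu>"
    using null_complement_of_measure_support[of \<nu>] cd by simp
  have sing: "measure \<nu> {x} = 0" for x
    using null[of "{x}"] by (auto simp: null_sets_def measure_def)
  have "measure \<nu> {c..d} = 1"
    using compl prob_compl[of "{c..d}"] by (auto simp: null_sets_def measure_def)
  then have "c < d" using sing[of c] by (cases "c = d"; cases "c < d") auto
  have "interval_law \<nu> c d"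
  proof (unfold_locales)
    show "c < d" by fact
    show "isCont (cdf \<nu>) s" for s using sing by (simp add: isCont_cdf)
    have "{..<c} \<in> null_sets \<nu>" by (rule null_sets_subset[OF compl]) auto
    then have "measure \<nu> {..<c} = 0" by (auto simp: null_sets_def measure_def)
    moreover have "measure \<nu> ({..<c} \<union> {c}) = measure \<nu> {..<c} + measure \<nu> {c}"
      by (rule finite_measure_Union) auto
    moreover have "{..<c} \<union> {c} = {..c}" by auto
    ultimately show "cdf \<nu> c = 0" using sing[of c] by (simp add: cdf_def2)
    have "{d<..} \<in> null_sets \<nu>" by (rule null_sets_subset[OF compl]) auto
    then have "measure \<nu> {d<..} = 0" by (auto simp: null_sets_def measure_def)
    moreover have "UNIV - {d<..} = {..d}" by auto
    ultimately show "cdf \<nu> d = 1" using prob_compl[of "{d<..}"] by (simp add: cdf_def2)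
  next
    fix s s' assume s: "c \<le> s" "s < s'" "s' \<le> d"
    define m where "m = (s + s') / 2"
    have "m \<in> measure_support \<nu>" using s by (simp add: cd m_def)
    then have "emeasure \<nu> {s<..<s'} > 0" using s by (auto simp: measure_support_def m_def)
    also have "emeasure \<nu> {s<..<s'} \<le> emeasure \<nu> {s<..s'}" by (intro emeasure_mono) auto
    finally have "measure \<nu> {s<..s'} > 0" by (simp add: emeasure_eq_measure)
    then show "cdf \<nu> s < cdf \<nu> s'" using cdf_diff_eq[OF s(2)] by simp
  qed
  then show thesis using that cd by blast
qed

section \<open>Monotone rearrangement of dominated laws\<close>

text \<open>The setting of the one-dimensional comparison: \<open>P\<close> will be the law of a 1-Lipschitz function with
range \<open>[a, b]\<close>, and \<open>N\<close> a null set outside of which the isoperimetric comparison can be used.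
\<open>P_slope\<close> is that comparison, and \<open>P_pos\<close> comes from essential connectedness.  The latter is
indispensable where \<open>\<nu>\<close> has zero density and at the levels met by \<open>N\<close>, where \<open>P_slope\<close> says
nothing.  The function \<open>cdf P\<close> may have jumps, since \<open>P\<close> may have atoms.\<close>

locale dominated_law = interval_law \<nu> c d + P: real_distribution P
  for \<nu> P :: "real measure" and c d +
  fixes a b :: real and N :: "real set"
  assumes ab: "a \<le> b"
    and cdf_below: "\<And>t. t < a \<Longrightarrow> cdf P t = 0"
    and cdf_above: "cdf P b = 1"
    and cdf_inside: "\<And>t. a < t \<Longrightarrow> t < b \<Longrightarrow> 0 < cdf P t \<and> cdf P t < 1"
    and N: "N \<in> null_sets \<nu>"
    and V_diff: "\<And>s. s \<notin> N \<Longrightarrow> cdf \<nu> field_differentiable at s"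
    and P_pos: "\<And>t. a < t \<Longrightarrow> t < b \<Longrightarrow>
      \<exists>\<alpha>>0. \<exists>\<^sub>F \<epsilon> in at_right 0. cdf P (t + \<epsilon>) - cdf P t \<ge> \<alpha> * \<epsilon>"
    and P_slope: "\<And>s t \<alpha>. s \<notin> N \<Longrightarrow> a < t \<Longrightarrow> t < b \<Longrightarrow> cdf P t = cdf \<nu> s \<Longrightarrow> \<alpha> < deriv (cdf \<nu>) s \<Longrightarrow>
      \<exists>\<^sub>F \<epsilon> in at_right 0. cdf P (t + \<epsilon>) - cdf P t \<ge> \<alpha> * \<epsilon>"
begin

lemma cdf_right_increment_bound:
  assumes s: "s \<notin> N" and D: "deriv (cdf \<nu>) s < D"
  shows "\<exists>\<delta>>0. \<forall>h. 0 \<le> h \<longrightarrow> h < \<delta> \<longrightarrow> cdf \<nu> (s + h) - cdf \<nu> s \<le> D * h"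
proof -
  have "DERIV (cdf \<nu>) s :> deriv (cdf \<nu>) s"
    using V_diff[OF s] by (simp add: field_differentiable_derivI)
  then have "((\<lambda>h. (cdf \<nu> (s + h) - cdf \<nu> s) / h) \<longlongrightarrow> deriv (cdf \<nu>) s) (at 0)"
    by (simp add: DERIV_def)
  from order_tendstoD(2)[OF this D] obtain \<delta> where \<delta>: "\<delta> > 0"
    "\<And>h. h \<noteq> 0 \<Longrightarrow> dist h 0 < \<delta> \<Longrightarrow> (cdf \<nu> (s + h) - cdf \<nu> s) / h < D"
    by (auto simp: eventually_at)
  have "cdf \<nu> (s + h) - cdf \<nu> s \<le> D * h" if "0 \<le> h" "h < \<delta>" for h
    using \<delta>(2)[of h] that by (cases "h = 0") (auto simp: field_simps)
  then show ?thesis using \<delta>(1) by blast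
qed

lemma deriv_cdf_nonneg:
  assumes "s \<notin> N" shows "deriv (cdf \<nu>) s \<ge> 0"
proof -
  have "DERIV (cdf \<nu>) s :> deriv (cdf \<nu>) s"
    using V_diff[OF assms] by (simp add: field_differentiable_derivI)
  then show ?thesis
    by (rule mono_on_imp_deriv_nonneg[where A = UNIV, rotated])
      (auto intro!: mono_onI cdf_nondecreasing)
qed

text \<open>This is the heart of the comparison: \<open>H = (cdf \<nu>)\<inverse> \<circ> cdf P\<close> expands distances.  Formally
\<open>H' = (cdf P)' / (cdf \<nu>)'\<close>, evaluated at corresponding points, and this is at least 1 by
\<open>P_slope\<close>, except when \<open>H\<close> takes a value in \<open>N\<close>.  Although \<open>N\<close> is null, it is not clear a
priori that this happens only on a null set of levels.  So one adds a correction \<open>\<Phi> \<circ> H\<close> of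
total variation at most \<open>e\<close> that is, by \<open>P_pos\<close>, infinitely steep at these levels.  The sum then
grows at rate at least \<open>\<theta>\<close> at every level, for any \<open>\<theta> < 1\<close>; finally \<open>e\<close> tends to 0 and
\<open>\<theta>\<close> to 1.\<close>

lemma quantile_expansion:
  assumes t: "a < t1" "t1 \<le> t2" "t2 < b"
    and s1: "cdf \<nu> s1 = cdf P t1" and s2: "cdf \<nu> s2 = cdf P t2"
  shows "t2 - t1 \<le> s2 - s1"
proof -
  define H where "H t = (SOME s. c \<le> s \<and> s \<le> d \<and> cdf \<nu> s = cdf P t)" for t
  have H: "c \<le> H t" "H t \<le> d" "cdf \<nu> (H t) = cdf P t" for t
  proof -
    obtain s where "c \<le> s" "s \<le> d" "cdf \<nu> s = cdf P t"
      using cdf_attains[OF P.cdf_nonneg P.cdf_bounded_prob] by metis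
    then have "c \<le> H t \<and> H t \<le> d \<and> cdf \<nu> (H t) = cdf P t"
      unfolding H_def by (intro someI[where P="\<lambda>s. c \<le> s \<and> s \<le> d \<and> cdf \<nu> s = cdf P t"]) auto
    then show "c \<le> H t" "H t \<le> d" "cdf \<nu> (H t) = cdf P t" by auto
  qed
  have Hlt: "c < H t" "H t < d" if "a < t" "t < b" for t
    using cdf_in_open_interval[of "H t"] cdf_inside[OF that] H(3)[of t] by auto
  have Heq: "s = H t" if "a < t" "t < b" "cdf \<nu> s = cdf P t" for s t
  proof -
    have "c < s" "s < d" using cdf_in_open_interval[of s] cdf_inside that by auto
    then show ?thesis
      using cdf_le_iff[of s "H t"] cdf_le_iff[of "H t" s] Hlt[OF that(1,2)] that(3) H(3)[of t] by auto
  qed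
  have Hmono: "H t \<le> H t'" if "a < t" "t \<le> t'" "t' < b" for t t'
    using cdf_le_iff[of "H t'" "H t"] Hlt[of t'] H(3) P.cdf_nondecreasing[OF that(2)] that by auto
  have key: "\<theta> * (t2 - t1) \<le> H t2 - H t1 + e" if th: "0 < \<theta>" "\<theta> < 1" and e: "0 < e" for \<theta> e
  proof -
    obtain \<Phi> where \<Phi>: "mono \<Phi>" "\<And>s. 0 \<le> \<Phi> s" "\<And>s. \<Phi> s \<le> e"
      "\<And>s m::nat. s \<in> N \<Longrightarrow> \<exists>\<delta>>0. \<forall>h. 0 \<le> h \<longrightarrow> h < \<delta> \<longrightarrow>
          \<Phi> (s + h) - \<Phi> s \<ge> real m * (cdf \<nu> (s + h) - cdf \<nu> s)"
      using steep_mono_on_null_set[OF N e] by blast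
    define K where "K t = H t + \<Phi> (H t)" for t
    have "K t2 - K t1 \<ge> \<theta> * (t2 - t1)"
    proof (rule growth_of_mono_from_right_increments)
      show "K x \<le> K y" if "t1 \<le> x" "x \<le> y" "y \<le> t2" for x y
        unfolding K_def using Hmono[of x y] monoD[OF \<Phi>(1), of "H x" "H y"] that t by auto
    next
      fix t assume tt: "t1 \<le> t" "t < t2"
      then have t': "a < t" "t < b" using t by auto
      let ?s = "H t"
      \<comment> \<open>If \<open>H\<close> increases by at least \<open>\<delta>\<close> over \<open>[t, t + \<epsilon>]\<close> with \<open>\<epsilon> < \<delta>\<close>, the claim is clear.
        So jumps of \<open>H\<close> do no harm, and local estimates at \<open>?s\<close> are enough.\<close>
      have jump: "\<exists>\<^sub>F \<epsilon> in at_right 0. K (t + \<epsilon>) - K t \<ge> \<theta> * \<epsilon>"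
        if \<delta>: "\<delta> > 0" and fr: "\<exists>\<^sub>F \<epsilon> in at_right 0. cdf P (t + \<epsilon>) - cdf P t \<ge> \<alpha> * \<epsilon>"
          and short: "\<And>\<epsilon> h. 0 < \<epsilon> \<Longrightarrow> 0 \<le> h \<Longrightarrow> h < \<delta> \<Longrightarrow> H (t + \<epsilon>) = ?s + h \<Longrightarrow>
              \<alpha> * \<epsilon> \<le> cdf \<nu> (?s + h) - cdf \<nu> ?s \<Longrightarrow>
              \<theta> * \<epsilon> \<le> h + (\<Phi> (?s + h) - \<Phi> ?s)" for \<delta> \<alpha>
      proof -
        have "\<forall>\<^sub>F \<epsilon> in at_right (0::real). \<epsilon> \<in> {0<..<min \<delta> (b - t)}"
          by (rule eventually_at_right_real) (use \<delta> t' in simp)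
        from frequently_eventually_conj[OF fr this] show ?thesis
        proof (rule frequently_elim1, elim conjE)
          fix \<epsilon> assume \<epsilon>: "\<alpha> * \<epsilon> \<le> cdf P (t + \<epsilon>) - cdf P t" "\<epsilon> \<in> {0<..<min \<delta> (b - t)}"
          define h where "h = H (t + \<epsilon>) - ?s"
          have h: "0 \<le> h" "H (t + \<epsilon>) = ?s + h"
            using Hmono[of t "t + \<epsilon>"] \<epsilon> t' by (auto simp: h_def)
          have "\<Phi> ?s \<le> \<Phi> (?s + h)" using monoD[OF \<Phi>(1), of ?s "?s + h"] h by simp
          moreover have "\<theta> * \<epsilon> \<le> \<delta>"
            using th \<epsilon> by (intro order_trans[OF mult_right_mono[of \<theta> 1 \<epsilon>]]) auto
          moreover have "\<theta> * \<epsilon> \<le> h + (\<Phi> (?s + h) - \<Phi> ?s)" if "h < \<delta>"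
            using short[OF _ h(1) that h(2)] \<epsilon> H(3)[of t] H(3)[of "t + \<epsilon>"] h by auto
          ultimately show "\<theta> * \<epsilon> \<le> K (t + \<epsilon>) - K t"
            using \<epsilon> h by (cases "h < \<delta>") (auto simp: K_def)
        qed
      qed
      obtain \<alpha> where \<alpha>: "\<alpha> > 0" "\<exists>\<^sub>F \<epsilon> in at_right 0. cdf P (t + \<epsilon>) - cdf P t \<ge> \<alpha> * \<epsilon>"
        using P_pos[OF t'] by blast
      show "\<exists>\<^sub>F \<epsilon> in at_right 0. K (t + \<epsilon>) - K t \<ge> \<theta> * \<epsilon>"
      proof (cases "?s \<in> N")
        case True
        \<comment> \<open>The steepness \<open>m\<close> of \<open>\<Phi>\<close> makes up for an arbitrarily small rate \<open>\<alpha>\<close>.\<close>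
        obtain m :: nat where m: "1 \<le> real m * \<alpha>"
          using reals_Archimedean3[OF \<alpha>(1)] by (meson less_imp_le)
        obtain \<delta> where \<delta>: "\<delta> > 0" "\<And>h. 0 \<le> h \<Longrightarrow> h < \<delta> \<Longrightarrow>
            \<Phi> (?s + h) - \<Phi> ?s \<ge> real m * (cdf \<nu> (?s + h) - cdf \<nu> ?s)"
          using \<Phi>(4)[OF True, of m] by blast
        show ?thesis
        proof (rule jump[OF \<delta>(1) \<alpha>(2)])
          fix \<epsilon> h assume *: "0 < \<epsilon>" "0 \<le> h" "h < \<delta>" "\<alpha> * \<epsilon> \<le> cdf \<nu> (?s + h) - cdf \<nu> ?s"
          have "\<theta> * \<epsilon> \<le> 1 * \<epsilon>" using th * by (intro mult_right_mono) auto
          also have "\<dots> \<le> real m * \<alpha> * \<epsilon>" using m * by (intro mult_right_mono) auto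
          also have "\<dots> \<le> real m * (cdf \<nu> (?s + h) - cdf \<nu> ?s)"
            using *(4) mult_left_mono[OF *(4), of "real m"] by (simp add: mult.assoc)
          also have "\<dots> \<le> \<Phi> (?s + h) - \<Phi> ?s" using \<delta>(2) * by simp
          finally show "\<theta> * \<epsilon> \<le> h + (\<Phi> (?s + h) - \<Phi> ?s)" using * by simp
        qed
      next
        case False
        let ?D = "deriv (cdf \<nu>) ?s"
        \<comment> \<open>For \<open>?D = 0\<close> the comparison is void and positivity of the boundary measure takes over.\<close>
        have "\<exists>\<beta>. \<theta> * ?D < \<beta> \<and> (\<exists>\<^sub>F \<epsilon> in at_right 0. cdf P (t + \<epsilon>) - cdf P t \<ge> \<beta> * \<epsilon>)"
        proof (cases "?D = 0")
          case True
          then show ?thesis using \<alpha> by auto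
        next
          case nz: False
          then have "\<theta> * ?D < ?D" using deriv_cdf_nonneg[OF False] th by simp
          then obtain \<beta> where "\<theta> * ?D < \<beta>" "\<beta> < ?D" using dense by blast
          then show ?thesis using P_slope[OF False t'] H(3)[of t] by (intro exI[of _ \<beta>]) auto
        qed
        then obtain \<beta> where \<beta>: "\<theta> * ?D < \<beta>"
          "\<exists>\<^sub>F \<epsilon> in at_right 0. cdf P (t + \<epsilon>) - cdf P t \<ge> \<beta> * \<epsilon>" by blast
        have "?D < \<beta> / \<theta>" using \<beta>(1) th by (simp add: field_simps)
        then obtain \<delta> where \<delta>: "\<delta> > 0"
          "\<And>h. 0 \<le> h \<Longrightarrow> h < \<delta> \<Longrightarrow> cdf \<nu> (?s + h) - cdf \<nu> ?s \<le> \<beta> / \<theta> * h"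
          using cdf_right_increment_bound[OF False] by blast
        have "\<beta> > 0" using \<beta>(1) deriv_cdf_nonneg[OF False] th
          by (smt (verit) mult_nonneg_nonneg)
        show ?thesis
        proof (rule jump[OF \<delta>(1) \<beta>(2)])
          fix \<epsilon> h assume *: "0 < \<epsilon>" "0 \<le> h" "h < \<delta>" "\<beta> * \<epsilon> \<le> cdf \<nu> (?s + h) - cdf \<nu> ?s"
          have "\<beta> * \<epsilon> \<le> \<beta> / \<theta> * h" using \<delta>(2) * by fastforce
          then have "\<theta> * \<epsilon> \<le> h" using \<open>\<beta> > 0\<close> th by (simp add: field_simps)
          then show "\<theta> * \<epsilon> \<le> h + (\<Phi> (?s + h) - \<Phi> ?s)"
            using monoD[OF \<Phi>(1), of ?s "?s + h"] * by simp
        qed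
      qed
    qed (use t th in auto)
    then show ?thesis using \<Phi>(2)[of "H t1"] \<Phi>(3)[of "H t2"] by (simp add: K_def)
  qed
  have "\<theta> * (t2 - t1) \<le> H t2 - H t1" if "0 < \<theta>" "\<theta> < 1" for \<theta>
    by (rule field_le_epsilon) (use key that in auto)
  then have "t2 - t1 \<le> H t2 - H t1"
    by (rule field_le_mult_one_interval)
  then show ?thesis using Heq[of t1 s1] Heq[of t2 s2] t s1 s2 by auto
qed

text \<open>The inverse of an expanding map is 1-Lipschitz: \<open>T\<close> is the quantile function of \<open>P\<close> composed
with \<open>cdf \<nu>\<close>, that is, the monotone rearrangement of \<open>\<nu>\<close> into \<open>P\<close>.\<close>

lemma lipschitz_transport:
  obtains T where "mono T" "1-lipschitz_on UNIV T" "distr \<nu> borel T = P"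
    "T c = a" "T d = b" "range T = {a..b}"
proof -
  \<comment> \<open>Without the restriction to \<open>[a, b]\<close> the set would be unbounded below for \<open>s \<le> c\<close>, where
    \<open>cdf \<nu> s = 0\<close>.\<close>
  define T where "T s = Inf {t\<in>{a..b}. cdf \<nu> s \<le> cdf P t}" for s
  have bS: "b \<in> {t\<in>{a..b}. cdf \<nu> s \<le> cdf P t}" for s
    using ab cdf_above cdf_bounded_prob[of s] by simp
  have bdd: "bdd_below {t\<in>{a..b}. cdf \<nu> s \<le> cdf P t}" for s by (auto simp: bdd_below_def)
  have Tge: "a \<le> T s" and Tle: "T s \<le> b" for s
    unfolding T_def using bS[of s] bdd[of s] by (auto intro!: cInf_greatest cInf_lower)
  have T_iff: "T s \<le> t \<longleftrightarrow> cdf \<nu> s \<le> cdf P t" if t: "a \<le> t" "t \<le> b" for s t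
  proof
    assume "cdf \<nu> s \<le> cdf P t"
    then show "T s \<le> t" unfolding T_def using t by (intro cInf_lower bdd) auto
  next
    assume le: "T s \<le> t"
    have "cdf \<nu> s \<le> cdf P x" if "x > t" for x
    proof -
      have "Inf {t\<in>{a..b}. cdf \<nu> s \<le> cdf P t} < x" using le that by (simp add: T_def)
      then obtain y where "y \<in> {t\<in>{a..b}. cdf \<nu> s \<le> cdf P t}" "y < x"
        using cInf_lessD[OF _ \<open>Inf _ < x\<close>] bS by blast
      then show ?thesis using P.cdf_nondecreasing[of y x] by auto
    qed
    then have ev: "\<forall>\<^sub>F x in at_right t. cdf \<nu> s \<le> cdf P x"
      by (simp add: eventually_at_right_less eventually_mono[OF eventually_at_right_less[of t]])
    have "(cdf P \<longlongrightarrow> cdf P t) (at_right t)"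
      using P.cdf_is_right_cont by (simp add: continuous_within)
    from tendsto_lowerbound[OF this ev] show "cdf \<nu> s \<le> cdf P t" by simp
  qed
  have mono: "mono T"
  proof (rule monoI)
    fix x y :: real assume "x \<le> y"
    then have "cdf \<nu> x \<le> cdf \<nu> y" by (rule cdf_nondecreasing)
    moreover have "cdf \<nu> y \<le> cdf P (T y)" using T_iff[of "T y" y] Tge Tle by simp
    ultimately show "T x \<le> T y" using T_iff[of "T y" x] Tge Tle by simp
  qed
  have lip: "T s2 - T s1 \<le> s2 - s1" if s: "s1 \<le> s2" for s1 s2
  proof (rule ccontr)
    assume "\<not> T s2 - T s1 \<le> s2 - s1"
    then have gap: "s2 - s1 < T s2 - T s1" by simp
    \<comment> \<open>Shrinking \<open>[T s1, T s2]\<close> by \<open>\<eta>\<close> on both sides leaves a length above \<open>s2 - s1\<close>.\<close>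
    define \<eta> where "\<eta> = (T s2 - T s1 - (s2 - s1)) / 3"
    define t1 where "t1 = T s1 + \<eta>"
    define t2 where "t2 = T s2 - \<eta>"
    have t: "T s1 < t1" "t1 < t2" "t2 < T s2" "t2 - t1 > s2 - s1"
      using gap s by (auto simp: \<eta>_def t1_def t2_def field_simps)
    have ab': "a < t1" "t2 < b" using t Tge[of s1] Tle[of s2] by auto
    obtain r1 where r1: "cdf \<nu> r1 = cdf P t1"
      using cdf_attains[OF P.cdf_nonneg P.cdf_bounded_prob] by metis
    obtain r2 where r2: "cdf \<nu> r2 = cdf P t2"
      using cdf_attains[OF P.cdf_nonneg P.cdf_bounded_prob] by metis
    have "t2 - t1 \<le> r2 - r1"
      using quantile_expansion[OF ab'(1) _ ab'(2) r1 r2] t by simp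
    moreover have "s1 \<le> r1"
    proof -
      have "cdf \<nu> s1 \<le> cdf \<nu> r1" using T_iff[of t1 s1] r1 t ab' by simp
      moreover have "c < r1" "r1 < d"
        using cdf_in_open_interval[of r1] cdf_inside[of t1] r1 t ab' by auto
      ultimately show ?thesis using cdf_le_iff[of r1 s1] by simp
    qed
    moreover have "r2 < s2"
    proof (rule ccontr)
      assume "\<not> r2 < s2"
      then have "cdf \<nu> s2 \<le> cdf P t2" using cdf_nondecreasing[of s2 r2] r2 by simp
      then show False using T_iff[of t2 s2] t ab' by simp
    qed
    ultimately show False using t by simp
  qed
  have lipU: "1-lipschitz_on UNIV T"
  proof (rule lipschitz_onI)
    fix x y :: real
    show "dist (T x) (T y) \<le> 1 * dist x y"
      using lip[of x y] lip[of y x] monoD[OF mono, of x y] monoD[OF mono, of y x]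
      by (cases "x \<le> y") (auto simp: dist_real_def)
  qed simp
  have [measurable]: "T \<in> borel_measurable borel" by (rule borel_measurable_mono[OF mono])
  have Tc: "T c = a"
    using T_iff[of a c] Tge[of c] ab cdf_c P.cdf_nonneg by (simp add: order_antisym)
  have Td: "T d = b"
  proof (rule ccontr)
    assume "T d \<noteq> b"
    then have "T d < b" using Tle[of d] by simp
    define t where "t = (T d + b) / 2"
    have "cdf \<nu> d \<le> cdf P t" "a < t" "t < b"
      using T_iff[of t d] \<open>T d < b\<close> Tge[of d] by (auto simp: t_def)
    then show False using cdf_inside[of t] cdf_d by simp
  qed
  have "range T = {a..b}"
  proof
    show "range T \<subseteq> {a..b}" using Tge Tle by auto
    show "{a..b} \<subseteq> range T"
    proof
      fix t assume "t \<in> {a..b}"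
      then have "T c \<le> t" "t \<le> T d" using Tc Td by auto
      then show "t \<in> range T"
        using IVT'[of T c t d] cd lipschitz_on_continuous_on[OF lipU] continuous_on_subset by fastforce
    qed
  qed
  moreover have "distr \<nu> borel T = P"
  proof (rule cdf_unique)
    show "real_distribution (distr \<nu> borel T)" by (rule real_distribution_distr) simp
    show "real_distribution P" by (rule P.real_distribution_axioms)
    show "cdf (distr \<nu> borel T) = cdf P"
    proof
      fix t
      have D: "cdf (distr \<nu> borel T) t = measure \<nu> {s. T s \<le> t}"
        by (simp add: cdf_def2 measure_distr vimage_def)
      consider "t < a" | "a \<le> t" "t < b" | "b \<le> t" by linarith
      then show "cdf (distr \<nu> borel T) t = cdf P t"
      proof cases
        case 1
        then have "{s. T s \<le> t} = {}" using Tge by (auto simp: not_le intro: less_le_trans)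
        then show ?thesis using D cdf_below[OF 1] by simp
      next
        case 3
        then have "{s. T s \<le> t} = UNIV" using Tle by (auto intro: order_trans)
        moreover have "cdf P t = 1"
          using P.cdf_nondecreasing[OF 3] cdf_above P.cdf_bounded_prob[of t] by simp
        ultimately show ?thesis using D prob_space by simp
      next
        case 2
        obtain s where s: "c \<le> s" "s \<le> d" "cdf \<nu> s = cdf P t"
          using cdf_attains[OF P.cdf_nonneg P.cdf_bounded_prob] by metis
        have "cdf P t < 1"
        proof -
          have "cdf P t \<le> cdf P ((t + b) / 2)" using 2 by (intro P.cdf_nondecreasing) auto
          then show ?thesis using cdf_inside[of "(t + b) / 2"] 2 by auto
        qed
        then have "s < d" using s cdf_d by (cases "s = d") auto
        then have "{s'. T s' \<le> t} = {..s}"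
          using T_iff[of t] cdf_le_iff[OF s(1)] 2 s(3) by auto
        then show ?thesis using D s(3) by (simp add: cdf_def2)
      qed
    qed
  qed
  ultimately show thesis using that mono lipU Tc Td by blast
qed

end

section \<open>Minimal geodesics\<close>

text \<open>The length of the curve is at least that of the polygon through \<open>\<gamma> a\<close>, \<open>\<gamma> s\<close>, \<open>\<gamma> t\<close> and \<open>\<gamma> b\<close>, so
for a minimal geodesic all triangle inequalities along this polygon are equalities.\<close>

lemma minimal_geodesic_dist_additive:
  assumes g: "minimal_geodesic \<gamma> a b" and st: "a \<le> s" "s \<le> t" "t \<le> b"
  shows "dist (\<gamma> a) (\<gamma> t) = dist (\<gamma> a) (\<gamma> s) + dist (\<gamma> s) (\<gamma> t)"
proof -
  define \<tau> where "\<tau> = (\<lambda>i::nat. if i = 0 then a else if i = 1 then s else if i = 2 then t else b)"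
  have "(\<Sum>i<3. ennreal (dist (\<gamma> (\<tau> i)) (\<gamma> (\<tau> (Suc i))))) \<le> curve_length \<gamma> a b"
    unfolding curve_length_def
    by (rule SUP_upper2[where i="(3, \<tau>)"]) (use st in \<open>auto simp: \<tau>_def numeral_3_eq_3 less_Suc_eq\<close>)
  also have "\<dots> = ennreal (dist (\<gamma> a) (\<gamma> b))" using g by (simp add: minimal_geodesic_def)
  also have "(\<Sum>i<3. ennreal (dist (\<gamma> (\<tau> i)) (\<gamma> (\<tau> (Suc i))))) =
      ennreal (dist (\<gamma> a) (\<gamma> s) + dist (\<gamma> s) (\<gamma> t) + dist (\<gamma> t) (\<gamma> b))"
    by (simp add: numeral_3_eq_3 \<tau>_def)
  finally have "dist (\<gamma> a) (\<gamma> s) + dist (\<gamma> s) (\<gamma> t) + dist (\<gamma> t) (\<gamma> b) \<le> dist (\<gamma> a) (\<gamma> b)"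
    by (simp del: ennreal_plus)
  then show ?thesis
    using dist_triangle[of "\<gamma> a" "\<gamma> b" "\<gamma> t"] dist_triangle[of "\<gamma> a" "\<gamma> t" "\<gamma> s"] by linarith
qed

lemma connected_geodesic_space:
  assumes "geodesic_space TYPE('a::metric_space)"
  shows "connected (UNIV :: 'a set)"
proof -
  fix p :: 'a
  have "\<exists>S. connected S \<and> p \<in> S \<and> q \<in> S" for q
  proof -
    obtain \<gamma> a b where g: "minimal_geodesic_joining \<gamma> a b p q"
      using assms unfolding geodesic_space_def by blast
    then have "connected (\<gamma> ` {a..b})"
      by (intro connected_continuous_image) (auto simp: minimal_geodesic_joining_def minimal_geodesic_def)
    moreover have "p \<in> \<gamma> ` {a..b}" "q \<in> \<gamma> ` {a..b}"
      using g by (auto simp: minimal_geodesic_joining_def minimal_geodesic_def)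
    ultimately show ?thesis by blast
  qed
  then have "\<And>q. connected_component UNIV p q" by (auto simp: connected_component_def)
  then show ?thesis
    by (metis connected_component_sym connected_component_trans connected_iff_connected_component)
qed


text \<open>Minimal geodesics parametrized by arclength and starting at parameter 0; they are easier to cut,
reverse and glue than curves of prescribed length.\<close>

definition isometric_curve :: "(real \<Rightarrow> 'a::metric_space) \<Rightarrow> real \<Rightarrow> bool" where
  "isometric_curve \<gamma> l \<longleftrightarrow> (\<forall>s\<in>{0..l}. \<forall>t\<in>{0..l}. dist (\<gamma> s) (\<gamma> t) = \<bar>s - t\<bar>)"

lemma isometric_curveD:
  "isometric_curve \<gamma> l \<Longrightarrow> 0 \<le> s \<Longrightarrow> s \<le> l \<Longrightarrow> 0 \<le> t \<Longrightarrow> t \<le> l \<Longrightarrow> dist (\<gamma> s) (\<gamma> t) = \<bar>s - t\<bar>"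
  by (simp add: isometric_curve_def)

lemma isometric_curveI:
  assumes "\<And>s t. 0 \<le> s \<Longrightarrow> s \<le> t \<Longrightarrow> t \<le> l \<Longrightarrow> dist (\<gamma> s) (\<gamma> t) = t - s"
  shows "isometric_curve \<gamma> l"
  unfolding isometric_curve_def
proof (intro ballI)
  fix s t assume "s \<in> {0..l}" "t \<in> {0..l}"
  then show "dist (\<gamma> s) (\<gamma> t) = \<bar>s - t\<bar>"
    using assms[of s t] assms[of t s] by (cases "s \<le> t") (auto simp: dist_commute)
qed

text \<open>Along a minimal geodesic the distance from the starting point is continuous and increasing, and
differences of it are distances on the curve; choosing a parameter for each of its values is the
arclength parametrization.\<close>

lemma geodesic_space_isometric_curve:
  fixes p q :: "'a::metric_space"
  assumes "geodesic_space TYPE('a)"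
  obtains \<gamma> where "isometric_curve \<gamma> (dist p q)" "\<gamma> 0 = p" "\<gamma> (dist p q) = q"
proof -
  obtain \<gamma> a b where g: "minimal_geodesic_joining \<gamma> a b p q"
    using assms unfolding geodesic_space_def by blast
  then have mg: "minimal_geodesic \<gamma> a b" and ends: "\<gamma> a = p" "\<gamma> b = q"
    by (auto simp: minimal_geodesic_joining_def)
  have ab: "a \<le> b" and cont: "continuous_on {a..b} \<gamma>" using mg by (auto simp: minimal_geodesic_def)
  define \<phi> where "\<phi> t = dist p (\<gamma> t)" for t
  have \<phi>: "dist (\<gamma> s) (\<gamma> t) = \<phi> t - \<phi> s" if "a \<le> s" "s \<le> t" "t \<le> b" for s t
    using minimal_geodesic_dist_additive[OF mg that] ends by (simp add: \<phi>_def)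
  have "continuous_on {a..b} \<phi>" unfolding \<phi>_def by (intro continuous_intros cont)
  then have "\<exists>t. a \<le> t \<and> t \<le> b \<and> \<phi> t = u" if "0 \<le> u" "u \<le> dist p q" for u
    using IVT'[of \<phi> a u b] ab that ends by (auto simp: \<phi>_def)
  then obtain \<tau> where \<tau>: "a \<le> \<tau> u" "\<tau> u \<le> b" "\<phi> (\<tau> u) = u" if "0 \<le> u" "u \<le> dist p q" for u
    by metis
  show thesis
  proof (rule that[of "\<lambda>u. \<gamma> (\<tau> u)"])
    show "isometric_curve (\<lambda>u. \<gamma> (\<tau> u)) (dist p q)"
    proof (rule isometric_curveI)
      fix s t assume st: "0 \<le> s" "s \<le> t" "t \<le> dist p q"
      show "dist (\<gamma> (\<tau> s)) (\<gamma> (\<tau> t)) = t - s"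
      proof (cases "\<tau> s \<le> \<tau> t")
        case True
        then show ?thesis using \<phi>[of "\<tau> s" "\<tau> t"] \<tau>[of s] \<tau>[of t] st by auto
      next
        case False
        then have "dist (\<gamma> (\<tau> t)) (\<gamma> (\<tau> s)) = s - t"
          using \<phi>[of "\<tau> t" "\<tau> s"] \<tau>[of s] \<tau>[of t] st by auto
        moreover have "0 \<le> dist (\<gamma> (\<tau> t)) (\<gamma> (\<tau> s))" by simp
        ultimately show ?thesis using st by (simp add: dist_commute)
      qed
    qed
    show "\<gamma> (\<tau> 0) = p" using \<tau>(3)[of 0] by (simp add: \<phi>_def)
    have "dist (\<gamma> (\<tau> (dist p q))) (\<gamma> b) = 0"
      using \<phi>[of "\<tau> (dist p q)" b] \<tau>[of "dist p q"] ends by (simp add: \<phi>_def)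
    then show "\<gamma> (\<tau> (dist p q)) = q" using ends by simp
  qed
qed

text \<open>Gluing preserves isometry as soon as the endpoints are as far apart as the total length allows,
because the triangle inequality then leaves no room for a shortcut.\<close>

lemma isometric_curve_concat:
  assumes \<gamma>: "isometric_curve \<gamma> k" and \<sigma>: "isometric_curve \<sigma> l" and kl: "0 \<le> k" "0 \<le> l"
    and join: "\<gamma> k = \<sigma> 0" and min: "dist (\<gamma> 0) (\<sigma> l) = k + l"
  shows "isometric_curve (\<lambda>t. if t \<le> k then \<gamma> t else \<sigma> (t - k)) (k + l)"
proof (rule isometric_curveI)
  fix s t assume st: "0 \<le> s" "s \<le> t" "t \<le> k + l"
  let ?\<tau> = "\<lambda>t. if t \<le> k then \<gamma> t else \<sigma> (t - k)"
  consider "t \<le> k" | "k < s" | "s \<le> k" "k < t" by linarith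
  then show "dist (?\<tau> s) (?\<tau> t) = t - s"
  proof cases
    case 1
    then show ?thesis using isometric_curveD[OF \<gamma>, of s t] st by auto
  next
    case 2
    then show ?thesis using isometric_curveD[OF \<sigma>, of "s - k" "t - k"] st by auto
  next
    case 3
    have "dist (\<gamma> 0) (\<gamma> s) = s" "dist (\<gamma> s) (\<gamma> k) = k - s"
      using isometric_curveD[OF \<gamma>, of 0 s] isometric_curveD[OF \<gamma>, of s k] 3 st by auto
    moreover have "dist (\<sigma> 0) (\<sigma> (t - k)) = t - k" "dist (\<sigma> (t - k)) (\<sigma> l) = l - (t - k)"
      using isometric_curveD[OF \<sigma>, of 0 "t - k"] isometric_curveD[OF \<sigma>, of "t - k" l] 3 st by auto
    moreover have "dist (\<gamma> s) (\<sigma> (t - k)) \<le> dist (\<gamma> s) (\<gamma> k) + dist (\<sigma> 0) (\<sigma> (t - k))"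
      using dist_triangle[of "\<gamma> s" "\<sigma> (t - k)" "\<gamma> k"] join by simp
    moreover have "dist (\<gamma> 0) (\<sigma> l) \<le> dist (\<gamma> 0) (\<gamma> s) + dist (\<gamma> s) (\<sigma> (t - k)) + dist (\<sigma> (t - k)) (\<sigma> l)"
      using dist_triangle[of "\<gamma> 0" "\<sigma> l" "\<gamma> s"] dist_triangle[of "\<gamma> s" "\<sigma> l" "\<sigma> (t - k)"] by linarith
    ultimately have "dist (\<gamma> s) (\<sigma> (t - k)) = t - s" using min by linarith
    then show ?thesis using 3 by simp
  qed
qed

lemma isometric_curve_reverse:
  assumes "isometric_curve \<gamma> l"
  shows "isometric_curve (\<lambda>t. \<gamma> (l - t)) l"
  by (rule isometric_curveI) (use isometric_curveD[OF assms] in auto)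

lemma isometric_curve_length:
  assumes \<gamma>: "isometric_curve \<gamma> l" and st: "0 \<le> s" "s \<le> t" "t \<le> l"
  shows "curve_length \<gamma> s t = ennreal (t - s)"
proof -
  let ?S = "{(n :: nat, \<tau> :: nat \<Rightarrow> real). \<tau> 0 = s \<and> \<tau> n = t \<and> (\<forall>i<n. \<tau> i \<le> \<tau> (Suc i))}"
  have "(\<Sum>i<n. ennreal (dist (\<gamma> (\<tau> i)) (\<gamma> (\<tau> (Suc i))))) = ennreal (t - s)"
    if \<tau>: "\<tau> 0 = s" "\<tau> n = t" "\<forall>i<n. \<tau> i \<le> \<tau> (Suc i)" for n and \<tau> :: "nat \<Rightarrow> real"
  proof -
    have mono: "\<tau> i \<le> \<tau> j" if "i \<le> j" "j \<le> n" for i j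
      using that
    proof (induction j rule: dec_induct)
      case (step j)
      then show ?case using \<tau>(3) by (metis Suc_le_eq less_imp_le order_trans)
    qed simp
    have bd: "0 \<le> \<tau> i" "\<tau> i \<le> l" if "i \<le> n" for i
      using mono[of 0 i] mono[of i n] that \<tau> st by auto
    have "(\<Sum>i<n. ennreal (dist (\<gamma> (\<tau> i)) (\<gamma> (\<tau> (Suc i))))) = (\<Sum>i<n. ennreal (\<tau> (Suc i) - \<tau> i))"
    proof (rule sum.cong)
      fix i assume "i \<in> {..<n}"
      then show "ennreal (dist (\<gamma> (\<tau> i)) (\<gamma> (\<tau> (Suc i)))) = ennreal (\<tau> (Suc i) - \<tau> i)"
        using isometric_curveD[OF \<gamma>, of "\<tau> i" "\<tau> (Suc i)"] bd[of i] bd[of "Suc i"] \<tau>(3) by auto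
    qed simp
    also have "\<dots> = ennreal (\<Sum>i<n. \<tau> (Suc i) - \<tau> i)" using \<tau>(3) by (intro sum_ennreal) auto
    also have "(\<Sum>i<n. \<tau> (Suc i) - \<tau> i) = t - s" using \<tau> by (simp add: sum_lessThan_telescope)
    finally show ?thesis .
  qed
  moreover have "(1, \<lambda>i. if i = 0 then s else t) \<in> ?S" using st by auto
  then have "?S \<noteq> {}" by blast
  ultimately show ?thesis
    unfolding curve_length_def by (intro SUP_eq_const) auto
qed

lemma isometric_curve_continuous:
  assumes "isometric_curve \<gamma> l"
  shows "continuous_on {0..l} \<gamma>"
  by (rule lipschitz_on_continuous_on[of 1], rule lipschitz_onI)
    (use isometric_curveD[OF assms] in \<open>auto simp: dist_real_def\<close>)

lemma isometric_curve_imp_minimal_geodesic: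
  assumes "isometric_curve \<gamma> l" "0 \<le> l"
  shows "minimal_geodesic \<gamma> 0 l" "arclength_parametrized \<gamma> 0 l"
  using assms isometric_curve_continuous[OF assms(1)] isometric_curve_length[OF assms(1)]
    isometric_curveD[OF assms(1), of 0 l]
  by (auto simp: minimal_geodesic_def arclength_parametrized_def)

lemma non_branching_isometric_curves:
  fixes \<gamma> \<sigma> :: "real \<Rightarrow> 'a::metric_space"
  assumes "non_branching TYPE('a)" "isometric_curve \<gamma> l" "isometric_curve \<sigma> l"
    and "0 < r" "r \<le> l" "\<And>t. 0 \<le> t \<Longrightarrow> t \<le> r \<Longrightarrow> \<gamma> t = \<sigma> t" and "0 \<le> t" "t \<le> l"
  shows "\<gamma> t = \<sigma> t"
proof -
  have "minimal_geodesic \<gamma> 0 l" "arclength_parametrized \<gamma> 0 l"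
    "minimal_geodesic \<sigma> 0 l" "arclength_parametrized \<sigma> 0 l"
    by (intro isometric_curve_imp_minimal_geodesic; use assms in simp)+
  moreover have "\<forall>t\<in>{0..r}. \<gamma> t = \<sigma> t" using assms(6) by auto
  ultimately have "\<not> (\<exists>t\<in>{0..l}. \<gamma> t \<noteq> \<sigma> t)"
    using assms(1,4,5) unfolding non_branching_def by blast
  then show ?thesis using assms(7,8) by auto
qed

text \<open>Two minimal geodesics that share their endpoints and an interior point can be interchanged after
that point, which would be branching unless they agree there; reversing them gives the other
half.\<close>

lemma non_branching_unique_through:
  fixes \<gamma> \<sigma> :: "real \<Rightarrow> 'a::metric_space"
  assumes nb: "non_branching TYPE('a)" and \<gamma>: "isometric_curve \<gamma> l" and \<sigma>: "isometric_curve \<sigma> l"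
    and ends: "\<gamma> 0 = \<sigma> 0" "\<gamma> l = \<sigma> l" and r: "0 < r" "r < l" "\<gamma> r = \<sigma> r"
    and t: "0 \<le> t" "t \<le> l"
  shows "\<gamma> t = \<sigma> t"
proof -
  \<comment> \<open>The hybrid \<open>\<tau>\<close> follows \<open>\<gamma>\<close> up to \<open>r\<close> and \<open>\<sigma>\<close> afterwards.\<close>
  have right: "\<gamma> t = \<sigma> t" if \<gamma>: "isometric_curve \<gamma> l" and \<sigma>: "isometric_curve \<sigma> l"
    and ends: "\<gamma> 0 = \<sigma> 0" "\<gamma> l = \<sigma> l" and r: "0 < r" "r < l" "\<gamma> r = \<sigma> r"
    and t: "r \<le> t" "t \<le> l" for \<gamma> \<sigma> :: "real \<Rightarrow> 'a" and r t
  proof -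
    define \<tau> where "\<tau> = (\<lambda>t. if t \<le> r then \<gamma> t else \<sigma> (r + (t - r)))"
    have "isometric_curve \<tau> (r + (l - r))"
      unfolding \<tau>_def
    proof (rule isometric_curve_concat)
      show "isometric_curve \<gamma> r" using \<gamma> r by (auto simp: isometric_curve_def)
      show "isometric_curve (\<lambda>t. \<sigma> (r + t)) (l - r)"
        using isometric_curveD[OF \<sigma>] r by (intro isometric_curveI) auto
      show "dist (\<gamma> 0) (\<sigma> (r + (l - r))) = r + (l - r)"
        using isometric_curveD[OF \<gamma>, of 0 l] ends r by simp
    qed (use r in auto)
    then have "isometric_curve \<tau> l" by simp
    from non_branching_isometric_curves[OF nb this \<gamma> r(1), of t] r t have "\<tau> t = \<gamma> t"
      by (auto simp: \<tau>_def)
    then show ?thesis using r t by (cases "t = r") (auto simp: \<tau>_def)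
  qed
  show ?thesis
  proof (cases "r \<le> t")
    case True
    then show ?thesis using right[OF \<gamma> \<sigma> ends r] t by blast
  next
    case False
    have "\<gamma> (l - (l - t)) = \<sigma> (l - (l - t))"
      by (rule right[OF isometric_curve_reverse[OF \<gamma>] isometric_curve_reverse[OF \<sigma>], of "l - r" "l - t"])
        (use ends r t False in auto)
    then show ?thesis by simp
  qed
qed

lemma isometric_curve_through_two_points:
  fixes p q :: "'a::metric_space"
  assumes geo: "geodesic_space TYPE('a)" and between: "dist p x + dist x y + dist y q = dist p q"
  obtains \<gamma> where "isometric_curve \<gamma> (dist p q)" "\<gamma> 0 = p" "\<gamma> (dist p x) = x"
    "\<gamma> (dist p x + dist x y) = y" "\<gamma> (dist p q) = q"
proof -
  obtain \<gamma>1 where 1: "isometric_curve \<gamma>1 (dist p x)" "\<gamma>1 0 = p" "\<gamma>1 (dist p x) = x"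
    using geodesic_space_isometric_curve[OF geo] .
  obtain \<gamma>2 where 2: "isometric_curve \<gamma>2 (dist x y)" "\<gamma>2 0 = x" "\<gamma>2 (dist x y) = y"
    using geodesic_space_isometric_curve[OF geo] .
  obtain \<gamma>3 where 3: "isometric_curve \<gamma>3 (dist y q)" "\<gamma>3 0 = y" "\<gamma>3 (dist y q) = q"
    using geodesic_space_isometric_curve[OF geo] .
  define \<sigma> where "\<sigma> = (\<lambda>t. if t \<le> dist p x then \<gamma>1 t else \<gamma>2 (t - dist p x))"
  have py: "dist p y = dist p x + dist x y"
    using between dist_triangle[of p y x] dist_triangle[of p q y] by linarith
  have \<sigma>: "isometric_curve \<sigma> (dist p x + dist x y)"
    unfolding \<sigma>_def by (rule isometric_curve_concat[OF 1(1) 2(1)]) (use 1 2 py in auto)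
  have \<sigma>': "\<sigma> 0 = p" "\<sigma> (dist p x) = x" "\<sigma> (dist p x + dist x y) = y"
    using 1 2 by (auto simp: \<sigma>_def)
  define \<tau> where "\<tau> = (\<lambda>t. if t \<le> dist p x + dist x y then \<sigma> t else \<gamma>3 (t - (dist p x + dist x y)))"
  have "isometric_curve \<tau> (dist p x + dist x y + dist y q)"
    unfolding \<tau>_def by (rule isometric_curve_concat[OF \<sigma> 3(1)]) (use 3 \<sigma>' between in auto)
  moreover have "\<tau> (dist p x + dist x y + dist y q) = q"
    using 3 \<sigma>' by (cases "y = q") (auto simp: \<tau>_def)
  moreover have "\<tau> 0 = p" "\<tau> (dist p x) = x" "\<tau> (dist p x + dist x y) = y"
    using \<sigma>' by (auto simp: \<tau>_def)
  ultimately show thesis using that[of \<tau>] between by simp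
qed

lemma minimal_geodesic_through_point:
  fixes p q :: "'a::metric_space"
  assumes geo: "geodesic_space TYPE('a)" and between: "dist p x + dist x q = dist p q"
  shows "\<exists>\<gamma> a b. minimal_geodesic_joining \<gamma> a b p q \<and> x \<in> \<gamma> ` {a..b}"
proof -
  obtain \<gamma> where \<gamma>: "isometric_curve \<gamma> (dist p q)" "\<gamma> 0 = p" "\<gamma> (dist p x) = x" "\<gamma> (dist p q) = q"
    using isometric_curve_through_two_points[OF geo, of p x x q] between by auto
  have "dist p x \<le> dist p q" using between zero_le_dist[of x q] by linarith
  then have "x \<in> \<gamma> ` {0..dist p q}" using \<gamma>(3) by (intro image_eqI[of _ _ "dist p x"]) auto
  then show ?thesis
    using isometric_curve_imp_minimal_geodesic(1)[OF \<gamma>(1)] \<gamma>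
    by (intro exI[of _ \<gamma>] exI[of _ 0] exI[of _ "dist p q"]) (auto simp: minimal_geodesic_joining_def)
qed

section \<open>Lipschitz functions under the isoperimetric comparison\<close>

lemma lipschitz_measurable:
  fixes f :: "'a::metric_space \<Rightarrow> real"
  assumes "1-lipschitz_on UNIV f" and N: "sets N = sets borel"
  shows "f \<in> borel_measurable N"
  unfolding measurable_cong_sets[OF N refl]
  using lipschitz_on_continuous_on[OF assms(1)] by (rule borel_measurable_continuous_onI)

lemma lipschitz_diff_le:
  fixes f :: "'a::metric_space \<Rightarrow> real"
  assumes "1-lipschitz_on UNIV f" shows "\<bar>f x - f y\<bar> \<le> dist x y"
  using lipschitz_onD[OF assms, of x y] by (simp add: dist_real_def)

lemma Limsup_gt_imp_frequently:
  fixes f :: "'b \<Rightarrow> 'c::complete_linorder"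
  assumes "y < Limsup F f"
  shows "\<exists>\<^sub>F x in F. y < f x"
proof (rule ccontr)
  assume "\<not> (\<exists>\<^sub>F x in F. y < f x)"
  then have "\<forall>\<^sub>F x in F. f x \<le> y" by (simp add: frequently_def not_less)
  then have "Limsup F f \<le> y" by (rule Limsup_bounded)
  with assms show False by simp
qed

lemma measure_pos_of_open:
  fixes M :: "'a::topological_space measure"
  assumes "finite_measure M" "measure_support M = UNIV" "open U" "U \<noteq> {}"
  shows "measure M U > 0"
proof -
  obtain x where "x \<in> U" using assms by blast
  moreover have "x \<in> measure_support M" using assms by simp
  ultimately have "emeasure M U > 0" using assms(3) unfolding measure_support_def by blast
  then show ?thesis using finite_measure.emeasure_eq_measure[OF assms(1)] by simp
qed

text \<open>The \<open>\<epsilon>\<close>-neighbourhood of a sublevel set of a 1-Lipschitz function lies in the sublevel set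
\<open>\<epsilon>\<close> higher up.  This turns boundary measure into growth of the distribution function.\<close>

lemma sublevel_growth_ge_boundary_measure:
  fixes f :: "'a::metric_space \<Rightarrow> real"
  assumes M: "finite_measure M" "sets M = sets borel"
    and f: "1-lipschitz_on UNIV f"
    and \<alpha>: "ereal \<alpha> < boundary_measure M {x. f x \<le> t}"
  shows "\<exists>\<^sub>F \<epsilon> in at_right 0. measure M {x. f x \<le> t + \<epsilon>} - measure M {x. f x \<le> t} \<ge> \<alpha> * \<epsilon>"
proof -
  let ?A = "{x. f x \<le> t}"
  have cont: "continuous_on UNIV f" using f by (rule lipschitz_on_continuous_on)
  have "\<exists>\<^sub>F \<epsilon> in at_right 0. ereal \<alpha> < ereal ((measure M (open_nbhd \<epsilon> ?A) - measure M ?A) / \<epsilon>)"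
    using \<alpha> unfolding boundary_measure_def by (rule Limsup_gt_imp_frequently)
  from frequently_eventually_conj[OF this eventually_at_right_less]
  show ?thesis
  proof (rule frequently_elim1, elim conjE)
    fix \<epsilon> :: real
    assume *: "ereal \<alpha> < ereal ((measure M (open_nbhd \<epsilon> ?A) - measure M ?A) / \<epsilon>)" "0 < \<epsilon>"
    have "open_nbhd \<epsilon> ?A \<subseteq> {x. f x \<le> t + \<epsilon>}"
    proof
      fix x assume "x \<in> open_nbhd \<epsilon> ?A"
      then obtain y where "f y \<le> t" "dist x y < \<epsilon>" by (auto simp: open_nbhd_def)
      then show "x \<in> {x. f x \<le> t + \<epsilon>}"
        using lipschitz_onD[OF f, of x y] by (auto simp: dist_real_def)
    qed
    moreover have "{x. f x \<le> t + \<epsilon>} \<in> sets M"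
      unfolding M(2) by (intro borel_closed closed_Collect_le cont continuous_intros)
    ultimately have "measure M (open_nbhd \<epsilon> ?A) \<le> measure M {x. f x \<le> t + \<epsilon>}"
      by (intro finite_measure.finite_measure_mono[OF M(1)])
    then show "\<alpha> * \<epsilon> \<le> measure M {x. f x \<le> t + \<epsilon>} - measure M ?A"
      using * by (simp add: field_simps)
  qed
qed

locale isoperimetric_comparison =
  fixes M :: "'a::polish_space measure" and \<nu> :: "real measure" and c d :: real
  assumes mm: "mm_space M"
    and compact: "compact (UNIV :: 'a set)"
    and geodesic: "geodesic_space TYPE('a)"
    and full_support: "measure_support M = UNIV"
    and ess_conn: "essentially_connected M"
    and ac: "absolutely_continuous lborel \<nu>"
    and law: "interval_law \<nu> c d"
    and ic: "IC M \<nu>"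
begin

sublocale M: prob_space M
  using mm by (simp add: mm_space_def)

sublocale interval_law \<nu> c d
  by (rule law)

lemma sets_M_eq [simp, measurable_cong]: "sets M = sets borel"
  using mm by (simp add: mm_space_def)

lemma space_M_eq [simp]: "space M = UNIV"
  using sets_eq_imp_space_eq[OF sets_M_eq] by simp

lemma measure_pos: "open U \<Longrightarrow> U \<noteq> {} \<Longrightarrow> measure M U > 0"
  using measure_pos_of_open[OF M.finite_measure_axioms full_support] .

text \<open>Full support makes every level strictly between the extrema of \<open>f\<close> have distribution function
strictly between 0 and 1, so that essential connectedness applies to all these sublevel sets.  If
the measure has atoms it may omit some values, but the isoperimetric comparison is only used at
measures of sublevel sets.\<close>

lemma lipschitz_is_transported:
  fixes f :: "'a \<Rightarrow> real"
  assumes f: "1-lipschitz_on UNIV f"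
  obtains T where "mono T" "1-lipschitz_on UNIV T" "distr M borel f = distr \<nu> borel T"
    "range T = range f" "range f = {T c..T d}"
proof -
  have cont: "continuous_on UNIV f" using f by (rule lipschitz_on_continuous_on)
  then have [measurable]: "f \<in> borel_measurable borel" by (rule borel_measurable_continuous_onI)
  have fM: "f \<in> borel_measurable M" by simp
  obtain a b where ran: "range f = {a..b}"
    using connected_compact_interval_1[of "range f"]
      connected_continuous_image[OF cont connected_geodesic_space[OF geodesic]]
      compact_continuous_image[OF cont compact] by auto
  define P where "P = distr M borel f"
  have cdfP: "cdf P t = measure M {x. f x \<le> t}" for t
    using fM by (simp add: P_def cdf_def2 measure_distr vimage_def)
  have fab: "a \<le> f x" "f x \<le> b" for x using ran by (auto simp: set_eq_iff)
  have surj: "\<exists>x. f x = t" if "a \<le> t" "t \<le> b" for t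
    using ran that by (metis atLeastAtMost_iff imageE)
  obtain N0 where N0: "N0 \<in> null_sets lborel"
    "{s. \<not> (cdf \<nu> field_differentiable at s \<and> (cdf \<nu> s \<in> measure_values M \<longrightarrow>
        isoperimetric_profile M (cdf \<nu> s) \<ge> ereal (deriv (cdf \<nu>) s)))} \<subseteq> N0"
  proof -
    have "AE s in lborel. cdf \<nu> field_differentiable at s \<and> (cdf \<nu> s \<in> measure_values M \<longrightarrow>
        isoperimetric_profile M (cdf \<nu> s) \<ge> ereal (deriv (cdf \<nu>) s))"
      using ic[unfolded IC_def] cdf_differentiable_AE[OF real_distribution_axioms ac]
      by eventually_elim auto
    then obtain N0 where "N0 \<in> null_sets lborel" "\<And>s. s \<notin> N0 \<Longrightarrow>
        cdf \<nu> field_differentiable at s \<and> (cdf \<nu> s \<in> measure_values M \<longrightarrow>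
        isoperimetric_profile M (cdf \<nu> s) \<ge> ereal (deriv (cdf \<nu>) s))"
      by (rule AE_E3) auto
    then show thesis by (intro that) auto
  qed
  have closed: "closed {x. f x \<le> t}" for t
    by (intro closed_Collect_le cont continuous_intros)
  have inside: "0 < cdf P t \<and> cdf P t < 1" if t: "a < t" "t < b" for t
  proof
    have lo: "open {x. f x < t}" and hi: "open {x. t < f x}"
      by (intro open_Collect_less cont continuous_intros)+
    have "{x. f x < t} \<noteq> {}" using surj[of a] t by auto
    then have "0 < measure M {x. f x < t}" using lo by (rule measure_pos[rotated])
    also have "\<dots> \<le> measure M {x. f x \<le> t}"
      using closed by (intro M.finite_measure_mono) (auto intro: borel_closed)
    finally show "0 < cdf P t" by (simp add: cdfP)
    have "{x. t < f x} \<noteq> {}" using surj[of b] t by auto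
    then have "0 < measure M {x. t < f x}" using hi by (rule measure_pos[rotated])
    moreover have "measure M (space M - {x. t < f x}) = 1 - measure M {x. t < f x}"
      using hi by (intro M.prob_compl) (auto intro: borel_open)
    moreover have "space M - {x. t < f x} = {x. f x \<le> t}" by auto
    ultimately show "cdf P t < 1" by (simp add: cdfP)
  qed
  have growth: "\<exists>\<^sub>F \<epsilon> in at_right 0. cdf P (t + \<epsilon>) - cdf P t \<ge> \<alpha> * \<epsilon>"
    if "ereal \<alpha> < boundary_measure M {x. f x \<le> t}" for \<alpha> t
    using sublevel_growth_ge_boundary_measure[OF M.finite_measure_axioms sets_M_eq f that]
    by (simp add: cdfP)
  interpret P: real_distribution P
    unfolding P_def using fM by (rule M.real_distribution_distr)
  interpret dominated_law \<nu> P c d a b N0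
  proof (unfold_locales)
    show "a \<le> b" using fab order_trans by blast
    show "cdf P t = 0" if "t < a" for t
    proof -
      have "{x. f x \<le> t} = {}" using fab(1) that by (auto simp: not_le intro: less_le_trans)
      then show ?thesis by (simp add: cdfP)
    qed
    have "{x. f x \<le> b} = space M" using fab(2) by auto
    then show "cdf P b = 1" by (simp add: cdfP M.prob_space del: space_M_eq)
    show "N0 \<in> null_sets \<nu>" using ac N0(1) by (auto simp: absolutely_continuous_def)
    show "cdf \<nu> field_differentiable at s" if "s \<notin> N0" for s using N0(2) that by auto
    show "0 < cdf P t \<and> cdf P t < 1" if "a < t" "t < b" for t by (rule inside) fact+
    show "\<exists>\<alpha>>0. \<exists>\<^sub>F \<epsilon> in at_right 0. cdf P (t + \<epsilon>) - cdf P t \<ge> \<alpha> * \<epsilon>" if t: "a < t" "t < b" for t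
    proof -
      have "0 < boundary_measure M {x. f x \<le> t}"
        using ess_conn closed inside[OF t] by (simp add: essentially_connected_def cdfP)
      then obtain \<alpha> where "0 < ereal \<alpha>" "ereal \<alpha> < boundary_measure M {x. f x \<le> t}"
        using ereal_dense2 by blast
      then show ?thesis using growth by auto
    qed
    show "\<exists>\<^sub>F \<epsilon> in at_right 0. cdf P (t + \<epsilon>) - cdf P t \<ge> \<alpha> * \<epsilon>"
      if "s \<notin> N0" "a < t" "t < b" "cdf P t = cdf \<nu> s" "\<alpha> < deriv (cdf \<nu>) s" for s t \<alpha>
    proof (rule growth)
      have A: "{x. f x \<le> t} \<in> sets M" using closed by (auto intro: borel_closed)
      then have "cdf \<nu> s \<in> measure_values M"
        using that(4) unfolding measure_values_def by (metis cdfP image_eqI)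
      then have "ereal (deriv (cdf \<nu>) s) \<le> isoperimetric_profile M (cdf \<nu> s)"
        using N0(2) that(1) by auto
      also have "\<dots> \<le> boundary_measure M {x. f x \<le> t}"
        unfolding isoperimetric_profile_def using A that(4) by (intro INF_lower) (simp add: cdfP)
      finally show "ereal \<alpha> < boundary_measure M {x. f x \<le> t}"
        using that(5) by (meson less_ereal.simps(1) order_less_le_trans)
    qed
  qed
  obtain T where "mono T" "1-lipschitz_on UNIV T" "distr \<nu> borel T = P"
    "T c = a" "T d = b" "range T = {a..b}" using lipschitz_transport by blast
  then show thesis by (intro that[of T]) (simp_all add: ran P_def)
qed

end

section \<open>Observable variance and diameter\<close>

text \<open>The bound on \<open>Var_fun lam M f\<close> that results when a 1-Lipschitz rearrangement has values at distance
at most \<open>R\<close>.\<close>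

definition capped_variance :: "(real \<Rightarrow> real) \<Rightarrow> real measure \<Rightarrow> real \<Rightarrow> ennreal" where
  "capped_variance lam \<nu> R = (\<integral>\<^sup>+x. \<integral>\<^sup>+x'. ennreal (lam (min \<bar>x - x'\<bar> R)) \<partial>\<nu> \<partial>\<nu>)"

lemma continuous_lam_abs:
  fixes lam :: "real \<Rightarrow> real"
  assumes "continuous_on {0..} lam"
  shows "continuous_on UNIV (\<lambda>r. lam \<bar>r\<bar>)"
  by (rule continuous_on_compose2[OF assms]) (auto intro!: continuous_intros)

lemma Var_fun_eq_Var_measure_distr:
  assumes lam: "continuous_on {0..} lam" and M: "finite_measure M" and f: "f \<in> borel_measurable M"
  shows "Var_fun lam M f = Var_measure lam (distr M borel f)"
proof -
  have [measurable]: "(\<lambda>r. lam \<bar>r\<bar>) \<in> borel_measurable borel"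
    using continuous_lam_abs[OF lam] by (rule borel_measurable_continuous_onI)
  have L: "(\<lambda>x. lam \<bar>g x - h x\<bar>) \<in> borel_measurable N"
    if "g \<in> borel_measurable N" "h \<in> borel_measurable N" for g h :: "_ \<Rightarrow> real" and N :: "'b measure"
    using measurable_compose[OF borel_measurable_diff[OF that] \<open>(\<lambda>r. lam \<bar>r\<bar>) \<in> _\<close>] by simp
  interpret D: finite_measure "distr M borel f"
    using f by (rule finite_measure.finite_measure_distr[OF M])
  have inner: "(\<integral>\<^sup>+x'. ennreal (lam \<bar>y - x'\<bar>) \<partial>distr M borel f) =
      (\<integral>\<^sup>+x'. ennreal (lam \<bar>y - f x'\<bar>) \<partial>M)" for y
    using f by (intro nn_integral_distr measurable_compose[OF _ measurable_ennreal] L) auto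
  have "(\<lambda>y. \<integral>\<^sup>+x'. ennreal (lam \<bar>y - x'\<bar>) \<partial>distr M borel f) \<in> borel_measurable borel"
    by (intro D.borel_measurable_nn_integral)
      (auto simp: case_prod_beta intro!: measurable_compose[OF _ measurable_ennreal] L)
  then have "Var_measure lam (distr M borel f) =
      (\<integral>\<^sup>+x. \<integral>\<^sup>+x'. ennreal (lam \<bar>f x - x'\<bar>) \<partial>distr M borel f \<partial>M)"
    unfolding Var_measure_def by (intro nn_integral_distr f) simp
  then show ?thesis by (simp add: inner Var_fun_def)
qed

context interval_law
begin

lemma AE_interval: "AE s in \<nu>. s \<in> {c..d}"
proof -
  have "AE s in \<nu>. c < s"
    using cdf_c by (intro AE_I[where N="{..c}"]) (auto simp: cdf_def2 emeasure_eq_measure)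
  moreover have "measure \<nu> {d<..} = 0"
    using cdf_d prob_compl[of "{..d}"] by (simp add: cdf_def2 Compl_eq_Diff_UNIV[symmetric])
  then have "AE s in \<nu>. s \<le> d"
    by (intro AE_I[where N="{d<..}"]) (auto simp: emeasure_eq_measure)
  ultimately show ?thesis by eventually_elim auto
qed

text \<open>The pairs of points near opposite ends of the support have positive measure, and there the cap
costs at least a fixed amount.  Since the bound does not depend on any function, the loss is
uniform, and no maximizer of the observable variance has to be found.\<close>

lemma capped_variance_less:
  assumes nonneg: "\<And>x. x \<ge> 0 \<Longrightarrow> lam x \<ge> 0" and smono: "strict_mono_on {0..} lam"
    and cont: "continuous_on {0..} lam" and R: "0 \<le> R" "R < d - c"
  shows "capped_variance lam \<nu> R < Var_measure lam \<nu>"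
proof -
  \<comment> \<open>Points of \<open>B\<close> and \<open>B'\<close> below are at distance at least \<open>R'\<close>, half-way between \<open>R\<close> and \<open>d - c\<close>.\<close>
  define \<eta> where "\<eta> = (d - c - R) / 4"
  define R' where "R' = d - c - 2 * \<eta>"
  define \<kappa> where "\<kappa> = lam R' - lam R"
  have \<eta>: "\<eta> > 0" "c + \<eta> < d" "c < d - \<eta>" "R < R'"
    using R cd by (auto simp: \<eta>_def R'_def field_simps)
  have lam_le: "lam x \<le> lam y" if "0 \<le> x" "x \<le> y" for x y
    using strict_mono_onD[OF smono, of x y] that by (cases "x = y") auto
  have \<kappa>: "\<kappa> > 0" using strict_mono_onD[OF smono, of R R'] \<eta> R by (simp add: \<kappa>_def)
  define B where "B = {..c + \<eta>}"
  define B' where "B' = {d - \<eta><..}"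
  have sets: "B \<in> sets borel" "B' \<in> sets borel" by (auto simp: B_def B'_def)
  have "measure \<nu> B > 0"
    using cdf_strict[of c "c + \<eta>"] \<eta> cdf_c by (simp add: B_def cdf_def2)
  moreover have "measure \<nu> B' > 0"
  proof -
    have "measure \<nu> B' = 1 - cdf \<nu> (d - \<eta>)"
      using prob_compl[of "{..d - \<eta>}"]
      by (simp add: B'_def cdf_def2 Compl_eq_Diff_UNIV[symmetric])
    then show ?thesis using cdf_strict[of "d - \<eta>" d] \<eta> cdf_d by simp
  qed
  ultimately have pos: "emeasure \<nu> B > 0" "emeasure \<nu> B' > 0" by (simp_all add: emeasure_eq_measure)
  define w where "w s s' = ennreal (lam (min \<bar>s - s'\<bar> R))" for s s'
  have "continuous_on UNIV (\<lambda>r. lam (min \<bar>r\<bar> R))"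
    by (rule continuous_on_compose2[OF cont]) (use R in \<open>auto intro!: continuous_intros\<close>)
  then have "(\<lambda>r. lam (min \<bar>r\<bar> R)) \<in> borel_measurable borel" by (rule borel_measurable_continuous_onI)
  from measurable_compose[OF borel_measurable_diff this]
  have L: "(\<lambda>x. lam (min \<bar>g x - h x\<bar> R)) \<in> borel_measurable N"
    if "g \<in> borel_measurable N" "h \<in> borel_measurable N" for g h and N :: "'x measure"
    using that by blast
  have w1: "(\<lambda>s'. w s s') \<in> borel_measurable \<nu>" for s
    unfolding w_def by (intro measurable_compose[OF _ measurable_ennreal] L) auto
  have w2: "(\<lambda>s. \<integral>\<^sup>+s'. w s s' \<partial>\<nu>) \<in> borel_measurable \<nu>"
    unfolding w_def by (intro borel_measurable_nn_integral)
      (auto simp: split_beta' intro!: measurable_compose[OF _ measurable_ennreal] L)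
  have le: "w s s' + ennreal \<kappa> * indicator B s * indicator B' s' \<le> ennreal (lam \<bar>s - s'\<bar>)" for s s'
  proof (cases "s \<in> B \<and> s' \<in> B'")
    case True
    then have "R' \<le> \<bar>s - s'\<bar>" by (auto simp: B_def B'_def R'_def)
    then have "lam (min \<bar>s - s'\<bar> R) + \<kappa> \<le> lam \<bar>s - s'\<bar>"
      using lam_le[of R' "\<bar>s - s'\<bar>"] \<eta> R by (simp add: \<kappa>_def min_def)
    then show ?thesis
      using True \<kappa> nonneg[of "min \<bar>s - s'\<bar> R"] R
      by (simp add: w_def ennreal_plus[symmetric] ennreal_leI del: ennreal_plus)
  next
    case False
    then show ?thesis
      using lam_le[of "min \<bar>s - s'\<bar> R" "\<bar>s - s'\<bar>"] R by (auto simp: w_def ennreal_leI indicator_def)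
  qed
  have "capped_variance lam \<nu> R \<le> (\<integral>\<^sup>+s. \<integral>\<^sup>+s'. ennreal (lam R) \<partial>\<nu> \<partial>\<nu>)"
    unfolding capped_variance_def by (intro nn_integral_mono ennreal_leI lam_le) (use R in auto)
  also have "\<dots> = ennreal (lam R)" using emeasure_space_1 by simp
  finally have fin: "capped_variance lam \<nu> R < \<top>"
    using ennreal_less_top order_le_less_trans by blast
  have "capped_variance lam \<nu> R < capped_variance lam \<nu> R + ennreal \<kappa> * emeasure \<nu> B' * emeasure \<nu> B"
    using fin pos \<kappa> by (simp add: ennreal_zero_less_mult_iff)
  also have "\<dots> = (\<integral>\<^sup>+s. \<integral>\<^sup>+s'. w s s' + ennreal \<kappa> * indicator B s * indicator B' s' \<partial>\<nu> \<partial>\<nu>)"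
  proof -
    have "(\<integral>\<^sup>+s'. w s s' + ennreal \<kappa> * indicator B s * indicator B' s' \<partial>\<nu>) =
        (\<integral>\<^sup>+s'. w s s' \<partial>\<nu>) + ennreal \<kappa> * emeasure \<nu> B' * indicator B s" for s
    proof -
      have "(\<integral>\<^sup>+s'. ennreal \<kappa> * indicator B s * indicator B' s' \<partial>\<nu>) =
          ennreal \<kappa> * indicator B s * emeasure \<nu> B'"
        using sets by (intro nn_integral_cmult_indicator) simp
      then show ?thesis using w1 sets by (subst nn_integral_add) (simp_all add: ac_simps)
    qed
    moreover have "(\<integral>\<^sup>+s. (\<integral>\<^sup>+s'. w s s' \<partial>\<nu>) + ennreal \<kappa> * emeasure \<nu> B' * indicator B s \<partial>\<nu>) =
        capped_variance lam \<nu> R + ennreal \<kappa> * emeasure \<nu> B' * emeasure \<nu> B"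
      using w2 sets unfolding capped_variance_def w_def[symmetric]
      by (subst nn_integral_add) (auto simp: nn_integral_cmult_indicator)
    ultimately show ?thesis by simp
  qed
  also have "\<dots> \<le> Var_measure lam \<nu>"
    unfolding Var_measure_def by (intro nn_integral_mono le)
  finally show ?thesis .
qed

lemma Var_measure_translate:
  assumes lam: "continuous_on {0..} lam"
  shows "Var_measure lam (distr \<nu> borel (\<lambda>s. s + k)) = Var_measure lam \<nu>"
  by (subst Var_fun_eq_Var_measure_distr[OF lam, symmetric])
    (simp_all add: finite_measure_axioms Var_fun_def Var_measure_def)

end

context isoperimetric_comparison
begin

lemma bounded_UNIV: "bounded (UNIV :: 'a set)"
  using compact by (rule compact_imp_bounded)

lemma dist_le_diameter: "dist x (y :: 'a) \<le> diameter (UNIV :: 'a set)"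
  using bounded_UNIV by (rule diameter_bounded_bound) auto

lemma lipschitz_dist: "1-lipschitz_on UNIV (dist (p :: 'a))"
proof (rule lipschitz_onI)
  fix x y :: 'a
  show "dist (dist p x) (dist p y) \<le> 1 * dist x y"
    using dist_triangle[of p x y] dist_triangle[of p y x]
    by (simp add: dist_real_def abs_le_iff dist_commute)
qed simp

text \<open>The distance from one end of a diameter takes the value of the diameter, whereas its range is the
1-Lipschitz image of an interval of length \<open>d - c\<close>.\<close>

lemma diameter_le: "diameter (UNIV :: 'a set) \<le> d - c"
proof -
  obtain p q :: 'a where pq: "dist p q = diameter (UNIV :: 'a set)"
    using diameter_compact_attained[OF compact] by auto
  obtain T where T: "1-lipschitz_on UNIV T" "range (dist p) = {T c..T d}"
    using lipschitz_is_transported[OF lipschitz_dist[of p]] by metis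
  have "dist p p \<in> {T c..T d}" "dist p q \<in> {T c..T d}" using T(2) by blast+
  then have "dist p q \<le> T d - T c" by auto
  also have "\<dots> \<le> d - c" using lipschitz_diff_le[OF T(1), of d c] cd by (simp add: dist_real_def)
  finally show ?thesis using pq by simp
qed

lemma Var_fun_le_capped_variance:
  assumes smono: "strict_mono_on {0..} lam" and cont: "continuous_on {0..} lam"
    and f: "1-lipschitz_on UNIV (f :: 'a \<Rightarrow> real)"
  shows "Var_fun lam M f \<le> capped_variance lam \<nu> (diameter (UNIV :: 'a set))"
proof -
  let ?R = "diameter (UNIV :: 'a set)"
  have lam_le: "lam x \<le> lam y" if "0 \<le> x" "x \<le> y" for x y
    using strict_mono_onD[OF smono, of x y] that by (cases "x = y") auto
  obtain T where T: "mono T" "1-lipschitz_on UNIV T" "distr M borel f = distr \<nu> borel T"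
    "range T = range f"
    using lipschitz_is_transported[OF f] by metis
  have fM: "f \<in> borel_measurable M"
    using f by (rule lipschitz_measurable) simp
  have T\<nu>: "T \<in> borel_measurable \<nu>"
    using T(2) by (rule lipschitz_measurable) simp
  have "Var_fun lam M f = Var_fun lam \<nu> T"
    using Var_fun_eq_Var_measure_distr[OF cont M.finite_measure_axioms fM]
      Var_fun_eq_Var_measure_distr[OF cont finite_measure_axioms T\<nu>] T(3) by simp
  also have "\<dots> \<le> capped_variance lam \<nu> ?R"
    unfolding Var_fun_def capped_variance_def
  proof (intro nn_integral_mono ennreal_leI lam_le)
    fix s s'
    obtain x y where "T s = f x" "T s' = f y" using T(4) by (metis rangeI imageE)
    then show "\<bar>T s - T s'\<bar> \<le> min \<bar>s - s'\<bar> ?R"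
      using lipschitz_diff_le[OF T(2), of s s'] lipschitz_diff_le[OF f, of x y] dist_le_diameter[of x y]
      by (simp add: dist_real_def)
  qed simp
  finally show ?thesis .
qed

text \<open>A 1-Lipschitz map of \<open>[c, d]\<close> whose image has length at least \<open>d - c\<close> and that increases from one
end to the other is a translation.\<close>

lemma extremal_law:
  assumes f: "1-lipschitz_on UNIV (f :: 'a \<Rightarrow> real)" and xy: "f y - f x = d - c"
  shows "distr M borel f = distr \<nu> borel (\<lambda>s. s + (f x - c))"
proof -
  obtain T where T: "mono T" "1-lipschitz_on UNIV T" "distr M borel f = distr \<nu> borel T"
    "range f = {T c..T d}"
    using lipschitz_is_transported[OF f] by metis
  have "f x \<in> {T c..T d}" "f y \<in> {T c..T d}" using T(4) by blast+
  moreover have "T d - T c \<le> d - c"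
    using lipschitz_diff_le[OF T(2), of d c] cd by (simp add: dist_real_def)
  ultimately have ends: "T c = f x" "T d = f x + (d - c)" using xy by auto
  have T_eq: "T s = s + (f x - c)" if "s \<in> {c..d}" for s
    using lipschitz_diff_le[OF T(2), of s c] lipschitz_diff_le[OF T(2), of d s] that ends
    by (auto simp: dist_real_def)
  have "T \<in> borel_measurable \<nu>"
    using T(2) by (rule lipschitz_measurable) simp
  then have "distr \<nu> borel T = distr \<nu> borel (\<lambda>s. s + (f x - c))"
    using eventually_mono[OF AE_interval T_eq] by (intro distr_cong_AE) simp_all
  then show ?thesis using T(3) by simp
qed

lemma diameter_eq_iff_ObsVar_eq:
  assumes nonneg: "\<And>x. x \<ge> 0 \<Longrightarrow> lam x \<ge> 0" and smono: "strict_mono_on {0..} lam"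
    and cont: "continuous_on {0..} lam"
  shows "diameter (UNIV :: 'a set) = d - c \<longleftrightarrow> ObsVar lam M = Var_measure lam \<nu>"
proof
  assume D: "diameter (UNIV :: 'a set) = d - c"
  obtain p q :: 'a where pq: "dist p q = diameter (UNIV :: 'a set)"
    using diameter_compact_attained[OF compact] by auto
  have lip: "1-lipschitz_on UNIV (dist p)" by (rule lipschitz_dist)
  have meas: "dist p \<in> borel_measurable M"
    using lip by (rule lipschitz_measurable) simp
  have "Var_fun lam M (dist p) = Var_measure lam (distr \<nu> borel (\<lambda>s. s + (dist p p - c)))"
    using Var_fun_eq_Var_measure_distr[OF cont M.finite_measure_axioms meas]
      extremal_law[OF lip, of q p] pq D by simp
  also have "\<dots> = Var_measure lam \<nu>" by (rule Var_measure_translate[OF cont])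
  finally have "Var_measure lam \<nu> \<le> ObsVar lam M"
    unfolding ObsVar_def using lip by (intro SUP_upper2[of "dist p"]) auto
  moreover have "ObsVar lam M \<le> Var_measure lam \<nu>"
    unfolding ObsVar_def
  proof (rule SUP_least)
    fix f :: "'a \<Rightarrow> real" assume "f \<in> {f. 1-lipschitz_on UNIV f}"
    then have "Var_fun lam M f \<le> capped_variance lam \<nu> (diameter (UNIV :: 'a set))"
      using Var_fun_le_capped_variance[OF smono cont] by simp
    also have "\<dots> \<le> Var_measure lam \<nu>"
      unfolding capped_variance_def Var_measure_def
    proof (intro nn_integral_mono ennreal_leI)
      fix s s' :: real
      show "lam (min \<bar>s - s'\<bar> (diameter (UNIV :: 'a set))) \<le> lam \<bar>s - s'\<bar>"
        using strict_mono_onD[OF smono, of "diameter (UNIV :: 'a set)" "\<bar>s - s'\<bar>"] D cd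
        by (auto simp: min_def not_le order_le_less)
    qed
    finally show "Var_fun lam M f \<le> Var_measure lam \<nu>" .
  qed
  ultimately show "ObsVar lam M = Var_measure lam \<nu>" by simp
next
  assume eq: "ObsVar lam M = Var_measure lam \<nu>"
  show "diameter (UNIV :: 'a set) = d - c"
  proof (rule ccontr)
    assume "diameter (UNIV :: 'a set) \<noteq> d - c"
    then have "diameter (UNIV :: 'a set) < d - c" using diameter_le by simp
    then have "capped_variance lam \<nu> (diameter (UNIV :: 'a set)) < Var_measure lam \<nu>"
      using diameter_ge_0[OF bounded_UNIV] nonneg by (intro capped_variance_less smono cont) auto
    moreover have "ObsVar lam M \<le> capped_variance lam \<nu> (diameter (UNIV :: 'a set))"
      unfolding ObsVar_def by (rule SUP_least) (simp add: Var_fun_le_capped_variance[OF smono cont])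
    ultimately show False using eq by simp
  qed
qed

text \<open>By the triangle inequality \<open>dist p\<close> dominates \<open>dist p q - dist q\<close>, and by \<open>extremal_law\<close> both
have the same law, hence the same mean.  So they agree almost everywhere, and everywhere by full
support.\<close>

lemma dist_add_eq_of_diameter_eq:
  fixes p q x :: 'a
  assumes D: "diameter (UNIV :: 'a set) = d - c" and pq: "dist p q = diameter (UNIV :: 'a set)"
  shows "dist p x + dist x q = dist p q"
proof -
  let ?D = "dist p q"
  define f where "f = dist p"
  define g where "g x = ?D - dist q x" for x
  have lf: "1-lipschitz_on UNIV f" unfolding f_def by (rule lipschitz_dist)
  have lg: "1-lipschitz_on UNIV g"
    using lipschitz_diff_le[OF lipschitz_dist[of q]]
    by (intro lipschitz_onI) (auto simp: g_def dist_real_def abs_minus_commute)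
  have contf: "continuous_on UNIV f" and contg: "continuous_on UNIV g"
    using lf lg by (auto intro: lipschitz_on_continuous_on)
  then have [measurable]: "f \<in> borel_measurable borel" "g \<in> borel_measurable borel"
    by (auto intro: borel_measurable_continuous_onI)
  have "distr M borel f = distr \<nu> borel (\<lambda>s. s + (f p - c))"
    using extremal_law[OF lf, of q p] pq D by (simp add: f_def)
  moreover have "distr M borel g = distr \<nu> borel (\<lambda>s. s + (g p - c))"
    using extremal_law[OF lg, of q p] pq D by (simp add: g_def dist_commute)
  moreover have "f p = g p" by (simp add: f_def g_def dist_commute)
  ultimately have "distr M borel f = distr M borel g" by simp
  moreover have "(\<integral>x. f x \<partial>M) = (\<integral>x. x \<partial>distr M borel f)" by (subst integral_distr) auto
  moreover have "(\<integral>x. g x \<partial>M) = (\<integral>x. x \<partial>distr M borel g)" by (subst integral_distr) auto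
  ultimately have int_eq: "(\<integral>x. f x \<partial>M) = (\<integral>x. g x \<partial>M)" by simp
  have intf: "integrable M f"
    using dist_le_diameter by (intro M.integrable_const_bound[where B="diameter (UNIV :: 'a set)"])
      (auto simp: f_def)
  have intg: "integrable M g"
    using dist_le_diameter
    by (intro M.integrable_const_bound[where B="diameter (UNIV :: 'a set)"])
      (auto simp: g_def pq)
  have ge: "g x \<le> f x" for x
    using dist_triangle[of p q x] by (simp add: f_def g_def dist_commute)
  have "AE x in M. f x - g x = 0"
    using int_eq intf intg ge
    by (subst integral_nonneg_eq_0_iff_AE[symmetric]) auto
  then have "AE x in M. \<not> g x < f x" by eventually_elim simp
  then have "measure M {x. g x < f x} = 0"
    by (subst M.prob_eq_0) (auto)
  moreover have "open {x. g x < f x}" by (intro open_Collect_less contf contg)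
  ultimately have "{x. g x < f x} = {}" using measure_pos by force
  then have "f x = g x" using ge[of x] by (metis (mono_tags) empty_iff mem_Collect_eq order_le_less)
  then show ?thesis by (simp add: f_def g_def dist_commute)
qed

end

section \<open>Suspensions\<close>

text \<open>The closed graph theorem for maps into a compact space, in a form where the graph is cut out
by a closed relation that is also meaningful outside \<open>S\<close>.\<close>

lemma continuous_on_of_closed_relation:
  fixes f :: "'a::topological_space \<Rightarrow> 'b::topological_space"
  assumes cpt: "compact (UNIV :: 'b set)" and R: "closed {(x, y). R x y}"
    and f: "\<And>x y. x \<in> S \<Longrightarrow> R x y \<longleftrightarrow> f x = y"
  shows "continuous_on S f"
  unfolding continuous_on_closed_invariant
proof (intro allI impI)
  fix B :: "'b set" assume B: "closed B"
  have "closed_map (prod_topology (euclidean :: 'a topology) (euclidean :: 'b topology)) euclidean fst"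
    using cpt by (intro Abstract_Topological_Spaces.closed_map_fst) (simp add: compact_space_def)
  moreover have "closed ({(x, y). R x y} \<inter> UNIV \<times> B)"
    using R B by (intro closed_Int closed_Times) auto
  ultimately have "closed (fst ` ({(x, y). R x y} \<inter> UNIV \<times> B))"
    by (simp add: closed_map_def euclidean_product_topology)
  moreover have "fst ` ({(x, y). R x y} \<inter> UNIV \<times> B) \<inter> S = f -` B \<inter> S"
    using f by (force simp: image_iff)
  ultimately show "\<exists>A. closed A \<and> A \<inter> S = f -` B \<inter> S" by blast
qed

lemma quotient_map_suspension:
  "quotient_map (prod_topology Y (top_of_set {0..1})) (suspension Y) (\<lambda>z. suspension_rel Y `` {z})"
  unfolding quotient_map_def
proof (intro conjI allI impI)
  let ?r = "suspension_rel Y" and ?A = "topspace Y \<times> {0..1::real}"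
  note eq = equiv_suspension_rel[of Y]
  show "(\<lambda>z. ?r `` {z}) ` topspace (prod_topology Y (top_of_set {0..1})) = topspace (suspension Y)"
    by (auto simp: topspace_suspension quotient_def)
  fix U assume "U \<subseteq> topspace (suspension Y)"
  then have U: "U \<subseteq> ?A // ?r" by (simp add: topspace_suspension)
  have "{z \<in> ?A. ?r `` {z} \<in> U} = \<Union>U"
  proof (intro equalityI subsetI)
    fix z assume "z \<in> {z \<in> ?A. ?r `` {z} \<in> U}"
    then show "z \<in> \<Union>U" using equiv_class_self[OF eq] by blast
  next
    fix z assume "z \<in> \<Union>U"
    then obtain C where C: "z \<in> C" "C \<in> U" by blast
    then have "C \<in> ?A // ?r" using U by blast
    then have "z \<in> ?A" "?r `` {z} = C"
      using C in_quotient_imp_subset[OF eq] Image_singleton quotientE[OF \<open>C \<in> ?A // ?r\<close>]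
      by (blast, metis (no_types, lifting) Image_singleton_iff eq equiv_class_eq quotientE)
    then show "z \<in> {z \<in> ?A. ?r `` {z} \<in> U}" using C by simp
  qed
  then show "openin (prod_topology Y (top_of_set {0..1}))
      {z \<in> topspace (prod_topology Y (top_of_set {0..1})). ?r `` {z} \<in> U} = openin (suspension Y) U"
    using U by (simp add: openin_suspension)
qed

text \<open>Both the projection onto the suspension and \<open>h\<close> identify the same points, so \<open>h\<close> descends to a
continuous bijection from a compact space to a Hausdorff space.\<close>

lemma homeomorphic_suspension_of_fibres:
  assumes h: "continuous_map (prod_topology Y (top_of_set {0..1})) X h"
    and surj: "h ` (topspace Y \<times> {0..1}) = topspace X"
    and Y: "compact_space Y" and X: "Hausdorff_space X"
    and fibres: "\<And>z z'. z \<in> topspace Y \<times> {0..1} \<Longrightarrow> z' \<in> topspace Y \<times> {0..1} \<Longrightarrow>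
      h z = h z' \<longleftrightarrow> (z, z') \<in> suspension_rel Y"
  shows "X homeomorphic_space suspension Y"
proof -
  let ?Z = "prod_topology Y (top_of_set {0..1::real})" and ?\<pi> = "\<lambda>z. suspension_rel Y `` {z}"
  have Z: "topspace ?Z = topspace Y \<times> {0..1}" by simp
  have \<pi>: "quotient_map ?Z (suspension Y) ?\<pi>" by (rule quotient_map_suspension)
  have rel: "(z, z') \<in> suspension_rel Y \<longleftrightarrow> ?\<pi> z = ?\<pi> z'"
    if "z \<in> topspace ?Z" "z' \<in> topspace ?Z" for z z'
    using eq_equiv_class_iff[OF equiv_suspension_rel[of Y], of z z'] that by simp
  obtain g where g: "continuous_map (suspension Y) X g" "g ` topspace (suspension Y) = h ` topspace ?Z"
    "\<And>z. z \<in> topspace ?Z \<Longrightarrow> g (?\<pi> z) = h z"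
    using quotient_map_lift_exists[OF \<pi> h] fibres rel by (metis (no_types, lifting) Z)
  have "compact_space ?Z"
    using Y by (simp add: compact_space_prod_topology compact_space_subtopology)
  then have "compact_space (suspension Y)"
    using image_compactin[OF _ quotient_imp_continuous_map[OF \<pi>]]
      quotient_imp_surjective_map[OF \<pi>]
    unfolding compact_space_def by metis
  moreover have "inj_on g (topspace (suspension Y))"
  proof (rule inj_onI)
    fix C C' assume C: "C \<in> topspace (suspension Y)" "C' \<in> topspace (suspension Y)" "g C = g C'"
    then obtain z z' where "z \<in> topspace ?Z" "C = ?\<pi> z" "z' \<in> topspace ?Z" "C' = ?\<pi> z'"
      using quotient_imp_surjective_map[OF \<pi>] by (metis (no_types, lifting) imageE)
    then show "C = C'" using C(3) g(3) fibres rel Z by metis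
  qed
  ultimately have "homeomorphic_map (suspension Y) X g"
    using g(1,2) surj Z by (intro continuous_imp_homeomorphic_map X) auto
  then show ?thesis
    by (meson homeomorphic_map_imp_homeomorphic_space homeomorphic_space_sym)
qed

text \<open>The base of the suspension is the set \<open>E\<close> of points half-way between the poles \<open>p\<close> and \<open>q\<close>, and
\<open>(y, s)\<close> corresponds to the point at height \<open>s\<close> of the unique minimal geodesic from \<open>p\<close> to \<open>q\<close>
through \<open>y\<close>.  This point \<open>x\<close> is determined by its distances to \<open>p\<close> and \<open>y\<close>, which is the relation
\<open>R\<close>: if they have the right values then \<open>p\<close>, \<open>x\<close>, \<open>y\<close>, \<open>q\<close> in some order lie on a minimal
geodesic.  As \<open>R\<close> is closed, continuity of the correspondence follows from compactness, without
any convergence argument for geodesics.\<close>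

lemma homeomorphic_suspension_between_poles:
  fixes p q :: "'a::metric_space"
  assumes cpt: "compact (UNIV :: 'a set)" and geo: "geodesic_space TYPE('a)"
    and nb: "non_branching TYPE('a)" and pq: "p \<noteq> q"
    and between: "\<And>x. dist p x + dist x q = dist p q"
  shows "\<exists>Y :: 'a topology. (euclidean :: 'a topology) homeomorphic_space suspension Y"
proof -
  define D where "D = dist p q"
  have D: "D > 0" using pq by (simp add: D_def)
  define E where "E = {y. dist p y = D / 2}"
  define R where "R = (\<lambda>z x. dist p x = snd z * D \<and> dist x (fst z) = \<bar>snd z - 1/2\<bar> * D)"
  have bet: "dist x q = D - dist p x" for x using between[of x] by (simp add: D_def)
  define curve where "curve \<gamma> \<longleftrightarrow> isometric_curve \<gamma> D \<and> \<gamma> 0 = p \<and> \<gamma> D = q" for \<gamma>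
  have uniq: "\<gamma> t = \<sigma> t"
    if "curve \<gamma>" "curve \<sigma>" "0 < r" "r < D" "\<gamma> r = \<sigma> r" "0 \<le> t" "t \<le> D" for \<gamma> \<sigma> r t
    using non_branching_unique_through[OF nb, of \<gamma> D \<sigma> r t] that by (simp add: curve_def)
  have R_curve: "\<exists>\<gamma>. curve \<gamma> \<and> \<gamma> (D / 2) = y \<and> \<gamma> (s * D) = x"
    if y: "y \<in> E" and s: "s \<in> {0..1}" and R: "R (y, s) x" for y s x
  proof (cases "s \<le> 1/2")
    case True
    then have xy: "dist x y = D / 2 - s * D" "dist p x = s * D"
      using R by (simp_all add: R_def algebra_simps)
    then have "dist p x + dist x y + dist y q = dist p q"
      using bet[of y] y by (simp add: E_def D_def)
    from isometric_curve_through_two_points[OF geo this]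
    show ?thesis using xy by (auto simp: curve_def D_def)
  next
    case False
    then have xy: "dist y x = s * D - D / 2" "dist p x = s * D"
      using R by (simp_all add: R_def algebra_simps dist_commute)
    moreover have py: "dist p y = D / 2" using y by (simp add: E_def)
    ultimately have "dist p y + dist y x + dist x q = dist p q"
      using bet[of x] by (simp add: D_def)
    from isometric_curve_through_two_points[OF geo this]
    show ?thesis using xy py by (auto simp: curve_def D_def)
  qed
  have curve_R: "R (\<gamma> (D / 2), s) (\<gamma> (s * D)) \<and> \<gamma> (D / 2) \<in> E"
    if \<gamma>: "curve \<gamma>" and s: "s \<in> {0..1}" for \<gamma> s
  proof -
    have sD: "0 \<le> s * D" "s * D \<le> D" using s D by (auto simp: mult_left_le_one_le)
    have "dist (\<gamma> 0) (\<gamma> (s * D)) = s * D" "dist (\<gamma> 0) (\<gamma> (D / 2)) = D / 2"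
      using isometric_curveD[of \<gamma> D 0 "s * D"] isometric_curveD[of \<gamma> D 0 "D / 2"] \<gamma> sD D
      by (auto simp: curve_def)
    moreover have "dist (\<gamma> (s * D)) (\<gamma> (D / 2)) = \<bar>s * D - D / 2\<bar>"
      using isometric_curveD[of \<gamma> D "s * D" "D / 2"] \<gamma> sD D by (auto simp: curve_def)
    moreover have "\<bar>s * D - D / 2\<bar> = \<bar>s - 1/2\<bar> * D"
      using D abs_mult[of "s - 1/2" D] by (simp add: algebra_simps)
    ultimately show ?thesis using \<gamma> by (simp add: R_def E_def curve_def)
  qed
  have ex_curve: "\<exists>\<gamma>. curve \<gamma> \<and> \<gamma> (dist p x) = x" for x
    using isometric_curve_through_two_points[OF geo, of p x x q] between[of x]
    by (auto simp: curve_def D_def)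
  have ex1: "\<exists>!x. R z x" if zE: "z \<in> E \<times> {0..1}" for z
  proof -
    obtain y s where z: "z = (y, s)" and y: "y \<in> E" and s: "s \<in> {0..1}" using zE by (metis mem_Times_iff prod.collapse)
    obtain \<gamma> where \<gamma>: "curve \<gamma>" "\<gamma> (D / 2) = y" using ex_curve[of y] y by (auto simp: E_def)
    have sD: "0 \<le> s * D" "s * D \<le> D" using s D by (auto simp: mult_left_le_one_le)
    have "x = \<gamma> (s * D)" if "R (y, s) x" for x
    proof -
      obtain \<sigma> where \<sigma>: "curve \<sigma>" "\<sigma> (D / 2) = y" "\<sigma> (s * D) = x" using R_curve[OF y s \<open>R (y, s) x\<close>] by blast
      then show ?thesis using uniq[OF \<sigma>(1) \<gamma>(1), of "D / 2" "s * D"] \<gamma>(2) D sD by simp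
    qed
    then show ?thesis using curve_R[OF \<gamma>(1) s] \<gamma>(2) z by (intro ex1I[of _ "\<gamma> (s * D)"]) auto
  qed
  define h where "h z = (THE x. R z x)" for z
  have h: "R z x \<longleftrightarrow> h z = x" if "z \<in> E \<times> {0..1}" for z x
    using ex1[OF that] theI'[OF ex1[OF that]] unfolding h_def by blast
  have "continuous_on (E \<times> {0..1}) h"
  proof (rule continuous_on_of_closed_relation[OF cpt _ h])
    have "closed {w :: ('a \<times> real) \<times> 'a. dist p (snd w) = snd (fst w) * D \<and>
        dist (snd w) (fst (fst w)) = \<bar>snd (fst w) - 1/2\<bar> * D}"
      by (intro closed_Collect_conj closed_Collect_eq continuous_intros)
    then show "closed {(z, x). R z x}" by (simp add: R_def split_beta')
  qed
  then have "continuous_map (prod_topology (top_of_set E) (top_of_set {0..1})) euclidean h"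
    by simp
  moreover have "h ` (E \<times> {0..1}) = UNIV"
  proof (intro equalityI subsetI)
    fix x :: 'a assume "x \<in> UNIV"
    obtain \<gamma> where \<gamma>: "curve \<gamma>" "\<gamma> (dist p x) = x" using ex_curve by blast
    define s where "s = dist p x / D"
    have "dist p x \<le> D" using bet[of x] zero_le_dist[of x q] by linarith
    then have s: "s \<in> {0..1}" "s * D = dist p x" using D by (auto simp: s_def)
    then have "R (\<gamma> (D / 2), s) x" "(\<gamma> (D / 2), s) \<in> E \<times> {0..1}"
      using curve_R[OF \<gamma>(1) s(1)] \<gamma>(2) by auto
    then show "x \<in> h ` (E \<times> {0..1})" using h by (metis image_eqI)
  qed simp
  moreover have "compact E"
  proof -
    have "closed E" unfolding E_def by (intro closed_Collect_eq continuous_intros)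
    then show ?thesis using compact_Int_closed[OF cpt] by simp
  qed
  moreover have "h z = h z' \<longleftrightarrow> (z, z') \<in> suspension_rel (top_of_set E)"
    if zz: "z \<in> E \<times> {0..1}" "z' \<in> E \<times> {0..1}" for z z'
  proof -
    obtain y s y' s' where z: "z = (y, s)" "z' = (y', s')" by (metis surj_pair)
    have mem: "y \<in> E" "s \<in> {0..1}" "y' \<in> E" "s' \<in> {0..1}" using zz z by auto
    have Rz: "R (y, s) (h z)" "R (y', s') (h z')" using h zz z by auto
    have "y = y' \<and> s = s' \<or> s = 0 \<and> s' = 0 \<or> s = 1 \<and> s' = 1" if eq: "h z = h z'"
    proof -
      have "s * D = s' * D" using Rz eq by (simp add: R_def)
      then have ss: "s = s'" using D by simp
      have "y = y'" if "0 < s" "s < 1"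
      proof -
        obtain \<gamma> where \<gamma>: "curve \<gamma>" "\<gamma> (D / 2) = y" "\<gamma> (s * D) = h z"
          using R_curve[OF mem(1,2) Rz(1)] by blast
        obtain \<sigma> where \<sigma>: "curve \<sigma>" "\<sigma> (D / 2) = y'" "\<sigma> (s' * D) = h z'"
          using R_curve[OF mem(3,4) Rz(2)] by blast
        have "\<gamma> (D / 2) = \<sigma> (D / 2)"
          by (rule uniq[OF \<gamma>(1) \<sigma>(1), of "s * D"]) (use that D \<gamma> \<sigma> ss eq in auto)
        then show ?thesis using \<gamma> \<sigma> by simp
      qed
      then show ?thesis using ss mem by force
    qed
    moreover have "h z = h z'" if "s = 0" "s' = 0" using Rz that by (simp add: R_def)
    moreover have "h z = h z'" if "s = 1" "s' = 1"
      using Rz that bet[of "h z"] bet[of "h z'"] by (simp add: R_def)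
    ultimately show ?thesis using z mem by (auto simp: suspension_rel_def)
  qed
  ultimately have "(euclidean :: 'a topology) homeomorphic_space suspension (top_of_set E)"
    by (intro homeomorphic_suspension_of_fibres[of _ _ h])
      (simp_all add: compact_space_subtopology Hausdorff_space_euclidean)
  then show ?thesis by blast
qed

section \<open>Diameter rigidity\<close>

theorem theorem1p5:
  fixes lam :: "real \<Rightarrow> real"
    and M :: "'a::polish_space measure"
    and \<nu> :: "real measure"
  assumes lam_nonneg: "\<And>x. x \<ge> 0 \<Longrightarrow> lam x \<ge> 0"
    and lam_mono: "strict_mono_on {0..} lam"
    and lam_cont: "continuous_on {0..} lam"
    and mm: "mm_space M"
    and compact: "compact (UNIV :: 'a set)"
    and geodesic: "geodesic_space TYPE('a)"
    and full_support: "measure_support M = UNIV"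
    and ess_conn: "essentially_connected M"
    and nu: "\<nu> \<in> class_V"
    and nu_compact: "compact (measure_support \<nu>)"
    and ic: "IC M \<nu>"
  shows "diameter (UNIV :: 'a set) \<le> diameter (measure_support \<nu>) \<and>
    (diameter (UNIV :: 'a set) = diameter (measure_support \<nu>) \<longleftrightarrow>
       ObsVar lam M = Var_measure lam \<nu>) \<and>
    (diameter (UNIV :: 'a set) = diameter (measure_support \<nu>) \<longrightarrow>
       (\<exists>p q :: 'a. dist p q = diameter (UNIV :: 'a set) \<and>
          (\<forall>x. \<exists>\<gamma> a b. minimal_geodesic_joining \<gamma> a b p q \<and> x \<in> \<gamma> ` {a..b})) \<and>
       (non_branching TYPE('a) \<longrightarrow>
          (\<exists>Y :: 'a topology. (euclidean :: 'a topology) homeomorphic_space suspension Y)))"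
proof -
  obtain c d where supp: "measure_support \<nu> = {c..d}" and law: "interval_law \<nu> c d"
    using interval_law_of_class_V[OF nu nu_compact] .
  interpret isoperimetric_comparison M \<nu> c d
    using mm compact geodesic full_support ess_conn nu law ic
    by (simp add: isoperimetric_comparison_def class_V_def)
  have diam: "diameter (measure_support \<nu>) = d - c"
    using cd by (simp add: supp)
  obtain p q :: 'a where pq: "dist p q = diameter (UNIV :: 'a set)"
    using diameter_compact_attained[OF compact] by auto
  show ?thesis
    unfolding diam
  proof (intro conjI impI)
    show "diameter (UNIV :: 'a set) \<le> d - c" by (rule diameter_le)
    show "diameter (UNIV :: 'a set) = d - c \<longleftrightarrow> ObsVar lam M = Var_measure lam \<nu>"
      by (rule diameter_eq_iff_ObsVar_eq[OF lam_nonneg lam_mono lam_cont])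
  next
    assume D: "diameter (UNIV :: 'a set) = d - c"
    have between: "dist p x + dist x q = dist p q" for x
      by (rule dist_add_eq_of_diameter_eq[OF D pq])
    show "\<exists>p q :: 'a. dist p q = diameter (UNIV :: 'a set) \<and>
        (\<forall>x. \<exists>\<gamma> a b. minimal_geodesic_joining \<gamma> a b p q \<and> x \<in> \<gamma> ` {a..b})"
      using pq minimal_geodesic_through_point[OF geodesic between] by blast
    show "\<exists>Y :: 'a topology. (euclidean :: 'a topology) homeomorphic_space suspension Y"
      if nb: "non_branching TYPE('a)"
    proof (rule homeomorphic_suspension_between_poles[OF compact geodesic nb _ between])
      show "p \<noteq> q" using pq D cd by auto
    qed
  qed
qed

end
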